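(* Let $a_i,b_i,w_i,p_i,u_i,v_i$ $(i\ge1)$ be commuting indeterminates. Let the extended seed sequences be $s^{(i)}_0=a_iw_iu_i$, $t^{(i)}_1=b_iw_ip_iv_i$, and $$s^{(i)}_\ell=\ell-1+a_i+w_i+\ell p_i\quad(\ell\ge1),\qquad t^{(i)}_\ell=(\ell-1+b_i)(\ell-1+w_i)p_i\quad(\ell\ge2).$$ Then for all $n,k\ge0$ the entry $a_{n,k}$ of the extended Catalan matrix satisfies $$a_{n,k}=\sum_{\pi\in \mathfrak{P}_{n,k}}\mathbf{a}^{\mathsf{Fix}(\pi)}\mathbf{b}^{\mathsf{Cyc}_{\ge 2}(\pi)}\mathbf{w}^{\mathsf{Rlmip}(\pi)}\mathbf{p}^{\mathsf{Excl}(\pi)}\mathbf{u}^{\mathsf{Sfix}(\pi)}\mathbf{v}^{\mathsf{Scyc}_{\ge2}(\pi)}.$$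
   Context: Extended Catalan matrix: given extended seeds $(s^{(i)}_\ell)_{\ell\ge0,i\ge1}$ and $(t^{(i)}_\ell)_{\ell\ge1,i\ge1}$, the matrix $(a_{n,k})_{n,k\ge0}$ is defined by $a_{0,0}=1$, $a_{0,k}=0$ for $k>0$, and $a_{n,k}=a_{n-1,k-1}+s^{(n)}_ka_{n-1,k}+t^{(n)}_{k+1}a_{n-1,k+1}$ for $n\ge1$, with $a_{n,-1}=0$. Partial permutations: a partial permutation of order $n$ is an $n\times n$ $(0,1)$-matrix $\pi=(\pi_{i,j})$ with at most one $1$ in each row and each column; $\mathfrak{P}_{n,k}$ is the set of those with exactly $k$ zero rows (for $n=0$ there is only the empty matrix, lying in $\mathfrak{P}_{0,0}$). Regard $\pi$ as the partial map $i\mapsto j$ whenever $\pi_{i,j}=1$; a full cycle of $\pi$ is a (closed) cycle of this partial map, fixed points being cycles of length $1$. Set-valued statistics: - $\mathsf{Fix}(\pi)=\{i:\pi_{i,i}=1\}$. - $\mathsf{Sfix}(\pi)$ is the set of strong fixed points: those $i$ with $\pi_{i,i}=1$ such that the principal submatrix of $\pi$ formed by the first $i$ rows and columns is a permutation matrix. - $\mathsf{Cyc}(\pi)=\{i: i \text{ is the largest number in a full cycle of }\pi\}$ and $\mathsf{Cyc}_{\ge2}(\pi)=\mathsf{Cyc}(\pi)\setminus\mathsf{Fix}(\pi)$. - A full cycle with largest number $i$ is a strong cycle if the principal submatrix formed by the first $i$ rows and columns is a permutation matrix; $\mathsf{Scyc}(\pi)=\{i:i\text{ is the largest number in a strong cycle}\}$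 and $\mathsf{Scyc}_{\ge2}(\pi)=\mathsf{Scyc}(\pi)\setminus\mathsf{Sfix}(\pi)$. - $\mathsf{Excl}(\pi)=\{j:\pi_{i,j}=1\text{ for some } i<j\}$. - $\mathsf{Rlmip}(\pi)$ is the set of $i$ such that $\pi_{i,j}=1$ for some $j$ which is a right-to-left minimum, i.e. for every column $1\le c<j$ there is a $1$ in column $c$ in some row $r<i$ (vacuous if $j=1$). For a finite set $S$ of positive integers, $\mathbf{x}^S=\prod_{i\in S}x_i$. *)

theory Defs
  imports Main
begin

text \<open>
  \<open>s i l\<close> and \<open>t i l\<close> stand for the seed entries with superscript \<open>i\<close> and subscript \<open>l\<close>;
  \<open>s\<close> is only used at \<open>i \<ge> 1\<close>, \<open>t\<close> only at \<open>i, l \<ge> 1\<close>.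
\<close>

fun ext_catalan :: "(nat \<Rightarrow> nat \<Rightarrow> 'a::comm_ring_1) \<Rightarrow> (nat \<Rightarrow> nat \<Rightarrow> 'a) \<Rightarrow> nat \<Rightarrow> nat \<Rightarrow> 'a" where
  "ext_catalan s t 0 k = (if k = 0 then 1 else 0)"
| "ext_catalan s t (Suc n) k =
     (if k = 0 then 0 else ext_catalan s t n (k - 1))
     + s (Suc n) k * ext_catalan s t n k
     + t (Suc n) (k + 1) * ext_catalan s t n (k + 1)"

text \<open>
  An \<open>n \<times> n\<close> matrix is a function on \<open>nat \<times> nat\<close> with rows and columns indexed from 1,
  padded with zeros outside \<open>{1..n} \<times> {1..n}\<close> so that distinct functions are distinct matrices.
\<close>

definition partial_perm :: "nat \<Rightarrow> (nat \<Rightarrow> nat \<Rightarrow> nat) \<Rightarrow> bool" where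
  "partial_perm n \<pi> \<longleftrightarrow>
     (\<forall>i j. \<pi> i j \<in> {0, 1}) \<and>
     (\<forall>i j. i \<notin> {1..n} \<or> j \<notin> {1..n} \<longrightarrow> \<pi> i j = 0) \<and>
     (\<forall>i j j'. \<pi> i j = 1 \<and> \<pi> i j' = 1 \<longrightarrow> j = j') \<and>
     (\<forall>i i' j. \<pi> i j = 1 \<and> \<pi> i' j = 1 \<longrightarrow> i = i')"

definition partial_perms :: "nat \<Rightarrow> nat \<Rightarrow> (nat \<Rightarrow> nat \<Rightarrow> nat) set" where
  "partial_perms n k =
     {\<pi>. partial_perm n \<pi> \<and> card {i \<in> {1..n}. \<forall>j\<in>{1..n}. \<pi> i j = 0} = k}"

definition leading_perm :: "(nat \<Rightarrow> nat \<Rightarrow> nat) \<Rightarrow> nat \<Rightarrow> bool" where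
  "leading_perm \<pi> m \<longleftrightarrow>
     (\<forall>r\<in>{1..m}. \<forall>c\<in>{1..m}. \<pi> r c \<in> {0, 1}) \<and>
     (\<forall>r\<in>{1..m}. \<exists>!c. c \<in> {1..m} \<and> \<pi> r c = 1) \<and>
     (\<forall>c\<in>{1..m}. \<exists>!r. r \<in> {1..m} \<and> \<pi> r c = 1)"

text \<open>\<open>C\<close> is the set of elements \<open>xs ! 0 \<mapsto> xs ! 1 \<mapsto> \<dots> \<mapsto> xs ! 0\<close> of a closed cycle.\<close>

definition full_cycle :: "(nat \<Rightarrow> nat \<Rightarrow> nat) \<Rightarrow> nat set \<Rightarrow> bool" where
  "full_cycle \<pi> C \<longleftrightarrow>
     (\<exists>xs. xs \<noteq> [] \<and> distinct xs \<and> set xs = C \<and>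
       (\<forall>m < length xs. \<pi> (xs ! m) (xs ! ((m + 1) mod length xs)) = 1))"

definition strong_cycle :: "(nat \<Rightarrow> nat \<Rightarrow> nat) \<Rightarrow> nat set \<Rightarrow> bool" where
  "strong_cycle \<pi> C \<longleftrightarrow> full_cycle \<pi> C \<and> leading_perm \<pi> (Max C)"

definition Fix :: "(nat \<Rightarrow> nat \<Rightarrow> nat) \<Rightarrow> nat set" where
  "Fix \<pi> = {i. \<pi> i i = 1}"

definition Sfix :: "(nat \<Rightarrow> nat \<Rightarrow> nat) \<Rightarrow> nat set" where
  "Sfix \<pi> = {i. \<pi> i i = 1 \<and> leading_perm \<pi> i}"

definition Cyc :: "(nat \<Rightarrow> nat \<Rightarrow> nat) \<Rightarrow> nat set" where
  "Cyc \<pi> = {Max C | C. full_cycle \<pi> C}"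

definition Cyc_ge2 :: "(nat \<Rightarrow> nat \<Rightarrow> nat) \<Rightarrow> nat set" where
  "Cyc_ge2 \<pi> = Cyc \<pi> - Fix \<pi>"

definition Scyc :: "(nat \<Rightarrow> nat \<Rightarrow> nat) \<Rightarrow> nat set" where
  "Scyc \<pi> = {Max C | C. strong_cycle \<pi> C}"

definition Scyc_ge2 :: "(nat \<Rightarrow> nat \<Rightarrow> nat) \<Rightarrow> nat set" where
  "Scyc_ge2 \<pi> = Scyc \<pi> - Sfix \<pi>"

definition Excl :: "(nat \<Rightarrow> nat \<Rightarrow> nat) \<Rightarrow> nat set" where
  "Excl \<pi> = {j. \<exists>i. i < j \<and> \<pi> i j = 1}"

definition Rlmip :: "(nat \<Rightarrow> nat \<Rightarrow> nat) \<Rightarrow> nat set" where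
  "Rlmip \<pi> = {i. \<exists>j. \<pi> i j = 1 \<and> (\<forall>c. 1 \<le> c \<and> c < j \<longrightarrow> (\<exists>r<i. \<pi> r c = 1))}"

text \<open>
  All index sets of the sums and products built from these definitions are finite, so none of
  them collapses to the default value for infinite sets.
\<close>

lemma partial_perm_entries: "partial_perm n \<pi> \<Longrightarrow> \<pi> i j \<in> {0, 1}"
  unfolding partial_perm_def by (drule conjunct1, drule spec, erule spec)

lemma partial_perm_outside:
  "partial_perm n \<pi> \<Longrightarrow> i \<notin> {1..n} \<or> j \<notin> {1..n} \<longrightarrow> \<pi> i j = 0"
  unfolding partial_perm_def
  by (drule conjunct2, drule conjunct1, drule spec, erule spec)

lemma finite_partial_perms: "finite (partial_perms n k)"
proof (rule finite_subset)
  let ?f = "\<lambda>S i j. if (i, j) \<in> S then 1 else (0::nat)"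
  show "partial_perms n k \<subseteq> ?f ` Pow ({1..n} \<times> {1..n})"
  proof
    fix \<pi> assume "\<pi> \<in> partial_perms n k"
    then have "partial_perm n \<pi>"
      by (simp add: partial_perms_def)
    note 01 = partial_perm_entries[OF this] and out = partial_perm_outside[OF this]
    have "\<pi> i j = ?f {(i, j). \<pi> i j = 1} i j" for i j
      using 01[of i j] by auto
    then have "\<pi> = ?f {(i, j). \<pi> i j = 1}"
      by (intro ext)
    moreover have "{(i, j). \<pi> i j = 1} \<subseteq> {1..n} \<times> {1..n}"
    proof clarify
      fix i j assume "\<pi> i j = 1"
      then show "i \<in> {1..n} \<and> j \<in> {1..n}"
        using out[of i j] by (cases "i \<in> {1..n} \<and> j \<in> {1..n}") auto
    qed
    ultimately show "\<pi> \<in> ?f ` Pow ({1..n} \<times> {1..n})"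
      by (intro image_eqI[where x = "{(i, j). \<pi> i j = 1}"] PowI)
  qed
qed simp

lemma finite_statistics:
  assumes "\<pi> \<in> partial_perms n k"
  shows "finite (Fix \<pi>)" "finite (Cyc_ge2 \<pi>)" "finite (Rlmip \<pi>)"
    "finite (Excl \<pi>)" "finite (Sfix \<pi>)" "finite (Scyc_ge2 \<pi>)"
proof -
  have supp: "i \<in> {1..n} \<and> j \<in> {1..n}" if "\<pi> i j = 1" for i j
  proof -
    have "partial_perm n \<pi>"
      using assms by (simp add: partial_perms_def)
    from partial_perm_outside[OF this, of i j] that show ?thesis
      by (cases "i \<in> {1..n} \<and> j \<in> {1..n}") auto
  qed
  have cyc: "Max C \<in> {1..n}" if C: "full_cycle \<pi> C" for C
  proof -
    obtain xs where xs: "xs \<noteq> []" "set xs = C"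
      and step: "\<forall>m < length xs. \<pi> (xs ! m) (xs ! ((m + 1) mod length xs)) = 1"
      using C[unfolded full_cycle_def] by (elim exE conjE) (rule that)
    have "C \<subseteq> {1..n}"
    proof
      fix x assume "x \<in> C"
      then obtain m where "m < length xs" "x = xs ! m"
        using xs(2) by (auto simp: in_set_conv_nth)
      then show "x \<in> {1..n}"
        using supp[OF step[rule_format]] by simp
    qed
    moreover have "Max C \<in> C"
      using xs by (auto intro: Max_in)
    ultimately show ?thesis by (rule subsetD)
  qed
  have "Fix \<pi> \<subseteq> {1..n}" "Sfix \<pi> \<subseteq> {1..n}" "Rlmip \<pi> \<subseteq> {1..n}" "Excl \<pi> \<subseteq> {1..n}"
    unfolding Fix_def Sfix_def Rlmip_def Excl_def by (auto simp del: One_nat_def dest: supp)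
  moreover have "Cyc_ge2 \<pi> \<subseteq> {1..n}" "Scyc_ge2 \<pi> \<subseteq> {1..n}"
    unfolding Cyc_ge2_def Scyc_ge2_def Cyc_def Scyc_def strong_cycle_def by (auto dest: cyc)
  ultimately show "finite (Fix \<pi>)" "finite (Cyc_ge2 \<pi>)" "finite (Rlmip \<pi>)"
    "finite (Excl \<pi>)" "finite (Sfix \<pi>)" "finite (Scyc_ge2 \<pi>)"
    by (simp_all add: finite_subset[OF _ finite_atLeastAtMost])
qed

end

theory Submission
  imports Defs "HOL-Library.Transitive_Closure_Table"
begin

text \<open>
  Membership of \<open>i\<close> in each of the six statistics depends only on the leading principal
  \<open>i \<times> i\<close> submatrix, so the weight of a matrix is a product of local weights, the
  \<open>i\<close>-th of which is determined when row and column \<open>i\<close> are appended. A matrix of order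
  \<open>n + 1\<close> arises from one of order \<open>n\<close> by putting nothing, or the corner entry, or an
  entry in a zero row, or in a zero column, or both, into the new border. The resulting sums
  of local weights are the three terms of the Catalan recurrence. Among the choices of a zero
  column \<open>j\<close> exactly one (the first) makes \<open>n + 1\<close> an element of \<open>Rlmip\<close>, and given \<open>j\<close>
  exactly one zero row (the end of the path from \<open>j\<close>) closes a cycle, which explains the
  factors \<open>k + w\<close> and \<open>k + b\<close>.
\<close>

subsection \<open>Appending a row and a column\<close>

text \<open>The inner quantifier is unbounded. For a partial permutation of order \<open>n\<close>
  it agrees with the bounded one in \<open>partial_perms\<close>, because all entries outside the
  square vanish.\<close>

definition zero_rows :: "nat \<Rightarrow> (nat \<Rightarrow> nat \<Rightarrow> nat) \<Rightarrow> nat set" where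
  "zero_rows n \<pi> = {i \<in> {1..n}. \<forall>j. \<pi> i j = 0}"

definition zero_cols :: "nat \<Rightarrow> (nat \<Rightarrow> nat \<Rightarrow> nat) \<Rightarrow> nat set" where
  "zero_cols n \<pi> = {j \<in> {1..n}. \<forall>i. \<pi> i j = 0}"

definition restr :: "nat \<Rightarrow> (nat \<Rightarrow> nat \<Rightarrow> nat) \<Rightarrow> nat \<Rightarrow> nat \<Rightarrow> nat" where
  "restr n \<pi> = (\<lambda>i j. if i \<le> n \<and> j \<le> n then \<pi> i j else 0)"

text \<open>Matrices are padded with zeros, so row and column \<open>n + 1\<close> are already
  there: appending a border means setting some of its cells to 1, and \<open>X = {}\<close> turns
  order \<open>n\<close> into order \<open>n + 1\<close> without changing the function.\<close>

definition place :: "(nat \<times> nat) set \<Rightarrow> (nat \<Rightarrow> nat \<Rightarrow> nat) \<Rightarrow> nat \<Rightarrow> nat \<Rightarrow> nat" where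
  "place X \<pi> = (\<lambda>i j. if (i, j) \<in> X then 1 else \<pi> i j)"

lemma finite_zero_rows [simp]: "finite (zero_rows n \<pi>)"
  and finite_zero_cols [simp]: "finite (zero_cols n \<pi>)"
  by (simp_all add: zero_rows_def zero_cols_def)

lemma partial_permD:
  assumes "partial_perm n \<pi>"
  shows "\<pi> i j = 0 \<or> \<pi> i j = 1"
    and "\<pi> i j \<noteq> 0 \<Longrightarrow> i \<in> {1..n} \<and> j \<in> {1..n}"
    and "\<pi> i j \<noteq> 0 \<Longrightarrow> \<pi> i j' \<noteq> 0 \<Longrightarrow> j = j'"
    and "\<pi> i j \<noteq> 0 \<Longrightarrow> \<pi> i' j \<noteq> 0 \<Longrightarrow> i = i'"
proof -
  have *: "\<pi> i j = 0 \<or> \<pi> i j = 1" for i j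
    using partial_perm_entries[OF assms, of i j] by blast
  show "\<pi> i j = 0 \<or> \<pi> i j = 1" by (rule *)
  show "\<pi> i j \<noteq> 0 \<Longrightarrow> i \<in> {1..n} \<and> j \<in> {1..n}"
    using partial_perm_outside[OF assms, of i j] by auto
  show "\<pi> i j \<noteq> 0 \<Longrightarrow> \<pi> i j' \<noteq> 0 \<Longrightarrow> j = j'"
    "\<pi> i j \<noteq> 0 \<Longrightarrow> \<pi> i' j \<noteq> 0 \<Longrightarrow> i = i'"
    using assms *[of i j] *[of i j'] *[of i' j] unfolding partial_perm_def by metis+
qed

lemma partial_permI:
  assumes "\<And>i j. \<pi> i j = 0 \<or> \<pi> i j = 1"
    and "\<And>i j. \<pi> i j \<noteq> 0 \<Longrightarrow> i \<in> {1..n} \<and> j \<in> {1..n}"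
    and "\<And>i j j'. \<pi> i j \<noteq> 0 \<Longrightarrow> \<pi> i j' \<noteq> 0 \<Longrightarrow> j = j'"
    and "\<And>i i' j. \<pi> i j \<noteq> 0 \<Longrightarrow> \<pi> i' j \<noteq> 0 \<Longrightarrow> i = i'"
  shows "partial_perm n \<pi>"
  unfolding partial_perm_def using assms by (metis insert_iff zero_neq_one)

lemma partial_perms_iff:
  "\<pi> \<in> partial_perms n k \<longleftrightarrow> partial_perm n \<pi> \<and> card (zero_rows n \<pi>) = k"
proof -
  have "{i \<in> {1..n}. \<forall>j\<in>{1..n}. \<pi> i j = 0} = zero_rows n \<pi>" if "partial_perm n \<pi>"
    unfolding zero_rows_def using partial_permD(2)[OF that] by blast
  then show ?thesis by (auto simp: partial_perms_def)
qed

text \<open>The ones sit in distinct rows and in distinct columns, so both projections of the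
  support are injective and miss equally many indices of \<open>{1..n}\<close>.\<close>

lemma card_zero_cols:
  assumes "partial_perm n \<pi>"
  shows "card (zero_cols n \<pi>) = card (zero_rows n \<pi>)"
proof -
  define S where "S = {(i, j). \<pi> i j \<noteq> 0}"
  have R: "zero_rows n \<pi> = {1..n} - fst ` S" and C: "zero_cols n \<pi> = {1..n} - snd ` S"
    by (force simp: zero_rows_def zero_cols_def S_def)+
  have sub: "fst ` S \<subseteq> {1..n}" "snd ` S \<subseteq> {1..n}"
    using partial_permD(2)[OF assms] by (auto simp: S_def)
  have "inj_on fst S" "inj_on snd S"
    using partial_permD(3,4)[OF assms] by (auto simp: S_def inj_on_def)
  then have "card (fst ` S) = card (snd ` S)"
    by (simp add: card_image)
  then show ?thesis
    unfolding R C using sub by (simp add: card_Diff_subset finite_subset[OF _ finite_atLeastAtMost])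
qed

lemma partial_perm_restr: "partial_perm m \<pi> \<Longrightarrow> partial_perm n (restr n \<pi>)"
  by (rule partial_permI; auto simp: restr_def split: if_splits dest: partial_permD)

section \<open>Effect of filling border cells\<close>

lemma restr_place:
  assumes "partial_perm n \<pi>" "\<And>i j. (i, j) \<in> X \<Longrightarrow> i = Suc n \<or> j = Suc n"
  shows "restr n (place X \<pi>) = \<pi>"
proof (intro ext)
  fix i j show "restr n (place X \<pi>) i j = \<pi> i j"
    using assms(2)[of i j] partial_permD(2)[OF assms(1), of i j] by (auto simp: restr_def place_def)
qed

lemma place_empty [simp]: "place {} \<pi> = \<pi>"
  by (simp add: place_def)

lemma partial_perm_Suc: "partial_perm n \<pi> \<Longrightarrow> partial_perm (Suc n) \<pi>"
  by (rule partial_permI) (fastforce dest: partial_permD)+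

lemma partial_perm_place1:
  assumes "partial_perm n \<pi>" "i \<in> {1..n}" "j \<in> {1..n}" "\<forall>j'. \<pi> i j' = 0" "\<forall>i'. \<pi> i' j = 0"
  shows "partial_perm n (place {(i, j)} \<pi>)"
  by (rule partial_permI)
    (use assms in \<open>auto simp: place_def split: if_splits dest: partial_permD\<close>)

lemma place_place: "place X (place Y \<pi>) = place (X \<union> Y) \<pi>"
  by (auto simp: place_def fun_eq_iff)

lemma last_row_col_zero:
  assumes "partial_perm n \<pi>"
  shows "\<pi> (Suc n) j = 0" "\<pi> i (Suc n) = 0"
  using partial_permD(2)[OF assms, of "Suc n" j] partial_permD(2)[OF assms, of i "Suc n"] by auto

lemma
  assumes \<pi>: "partial_perm n \<pi>"
  shows partial_perm_corner: "partial_perm (Suc n) (place {(Suc n, Suc n)} \<pi>)"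
    and partial_perm_col: "i \<in> zero_rows n \<pi> \<Longrightarrow> partial_perm (Suc n) (place {(i, Suc n)} \<pi>)"
    and partial_perm_row: "j \<in> zero_cols n \<pi> \<Longrightarrow> partial_perm (Suc n) (place {(Suc n, j)} \<pi>)"
    and partial_perm_row_col: "i \<in> zero_rows n \<pi> \<Longrightarrow> j \<in> zero_cols n \<pi> \<Longrightarrow>
      partial_perm (Suc n) (place {(i, Suc n), (Suc n, j)} \<pi>)"
proof -
  note Z = last_row_col_zero[OF \<pi>] and S = partial_perm_Suc[OF \<pi>]
  show "partial_perm (Suc n) (place {(Suc n, Suc n)} \<pi>)"
    by (rule partial_perm_place1[OF S]) (simp_all add: Z)
  show "partial_perm (Suc n) (place {(i, Suc n)} \<pi>)" if "i \<in> zero_rows n \<pi>"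
    by (rule partial_perm_place1[OF S]) (use that in \<open>auto simp: Z zero_rows_def\<close>)
  show row: "partial_perm (Suc n) (place {(Suc n, j)} \<pi>)" if "j \<in> zero_cols n \<pi>"
    by (rule partial_perm_place1[OF S]) (use that in \<open>auto simp: Z zero_cols_def\<close>)
  assume i: "i \<in> zero_rows n \<pi>" and j: "j \<in> zero_cols n \<pi>"
  \<comment> \<open>The cells are set one at a time. As \<open>i\<close> and \<open>j\<close> are at
    most \<open>n\<close>, setting \<open>(Suc n, j)\<close> leaves row \<open>i\<close> and column
    \<open>n + 1\<close> zero.\<close>
  have "partial_perm (Suc n) (place {(i, Suc n)} (place {(Suc n, j)} \<pi>))"
    by (rule partial_perm_place1[OF row[OF j]])
      (use i j in \<open>auto simp: Z zero_cols_def zero_rows_def place_def\<close>)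
  then show "partial_perm (Suc n) (place {(i, Suc n), (Suc n, j)} \<pi>)"
    by (simp add: place_place insert_commute)
qed

lemma
  assumes \<pi>: "partial_perm n \<pi>"
  shows zero_rows_empty: "zero_rows (Suc n) \<pi> = insert (Suc n) (zero_rows n \<pi>)"
    and zero_rows_corner: "zero_rows (Suc n) (place {(Suc n, Suc n)} \<pi>) = zero_rows n \<pi>"
    and zero_rows_col: "i \<in> zero_rows n \<pi> \<Longrightarrow>
      zero_rows (Suc n) (place {(i, Suc n)} \<pi>) = insert (Suc n) (zero_rows n \<pi> - {i})"
    and zero_rows_row: "zero_rows (Suc n) (place {(Suc n, j)} \<pi>) = zero_rows n \<pi>"
    and zero_rows_row_col: "i \<in> zero_rows n \<pi> \<Longrightarrow>
      zero_rows (Suc n) (place {(i, Suc n), (Suc n, j)} \<pi>) = zero_rows n \<pi> - {i}"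
proof -
  have "i \<in> {1..Suc n} \<longleftrightarrow> i \<in> {1..n} \<or> i = Suc n" "i \<in> {1..n} \<Longrightarrow> i \<noteq> Suc n" for i
    by auto
  note * = this last_row_col_zero[OF \<pi>]
  show "zero_rows (Suc n) \<pi> = insert (Suc n) (zero_rows n \<pi>)"
    "zero_rows (Suc n) (place {(Suc n, Suc n)} \<pi>) = zero_rows n \<pi>"
    "i \<in> zero_rows n \<pi> \<Longrightarrow>
      zero_rows (Suc n) (place {(i, Suc n)} \<pi>) = insert (Suc n) (zero_rows n \<pi> - {i})"
    "zero_rows (Suc n) (place {(Suc n, j)} \<pi>) = zero_rows n \<pi>"
    "i \<in> zero_rows n \<pi> \<Longrightarrow>
      zero_rows (Suc n) (place {(i, Suc n), (Suc n, j)} \<pi>) = zero_rows n \<pi> - {i}"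
    unfolding zero_rows_def place_def set_eq_iff mem_Collect_eq *(1) using *(2-)
    by (auto split: if_splits)
qed

lemma Suc_notin_zero [simp]: "Suc n \<notin> zero_rows n \<pi>" "Suc n \<notin> zero_cols n \<pi>"
  by (simp_all add: zero_rows_def zero_cols_def)

text \<open>The new row is a further zero row unless it receives a 1, and a 1 in the new column
  above the corner uses up an old zero row. So the number of zero rows changes by 1, 0 or -1,
  matching the three neighbours in the Catalan recurrence.\<close>

lemma
  assumes "\<pi> \<in> partial_perms n l"
  shows partial_perms_empty: "\<pi> \<in> partial_perms (Suc n) k \<longleftrightarrow> k = Suc l"
    and partial_perms_corner: "place {(Suc n, Suc n)} \<pi> \<in> partial_perms (Suc n) k \<longleftrightarrow> k = l"
    and partial_perms_col: "i \<in> zero_rows n \<pi> \<Longrightarrow>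
      place {(i, Suc n)} \<pi> \<in> partial_perms (Suc n) k \<longleftrightarrow> k = l"
    and partial_perms_row: "j \<in> zero_cols n \<pi> \<Longrightarrow>
      place {(Suc n, j)} \<pi> \<in> partial_perms (Suc n) k \<longleftrightarrow> k = l"
    and partial_perms_row_col: "i \<in> zero_rows n \<pi> \<Longrightarrow> j \<in> zero_cols n \<pi> \<Longrightarrow>
      place {(i, Suc n), (Suc n, j)} \<pi> \<in> partial_perms (Suc n) k \<longleftrightarrow> Suc k = l"
proof -
  have \<pi>: "partial_perm n \<pi>" and l: "card (zero_rows n \<pi>) = l"
    using assms by (simp_all add: partial_perms_iff)
  \<comment> \<open>An available row \<open>i\<close> makes \<open>l\<close> positive, so the
    truncated \<open>l - 1\<close> is a true predecessor.\<close>
  have l0: "l > 0" if "i \<in> zero_rows n \<pi>"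
    using that l by (auto simp: card_gt_0_iff)
  show "\<pi> \<in> partial_perms (Suc n) k \<longleftrightarrow> k = Suc l"
    "place {(Suc n, Suc n)} \<pi> \<in> partial_perms (Suc n) k \<longleftrightarrow> k = l"
    "i \<in> zero_rows n \<pi> \<Longrightarrow> place {(i, Suc n)} \<pi> \<in> partial_perms (Suc n) k \<longleftrightarrow> k = l"
    "j \<in> zero_cols n \<pi> \<Longrightarrow> place {(Suc n, j)} \<pi> \<in> partial_perms (Suc n) k \<longleftrightarrow> k = l"
    "i \<in> zero_rows n \<pi> \<Longrightarrow> j \<in> zero_cols n \<pi> \<Longrightarrow>
      place {(i, Suc n), (Suc n, j)} \<pi> \<in> partial_perms (Suc n) k \<longleftrightarrow> Suc k = l"
    using \<pi> l l0 partial_perm_Suc[OF \<pi>]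
    by (auto simp: partial_perms_iff partial_perm_corner partial_perm_col partial_perm_row
        partial_perm_row_col zero_rows_empty zero_rows_corner zero_rows_col zero_rows_row
        zero_rows_row_col card_Diff_singleton card_insert_if)
qed

section \<open>Decomposition of a matrix of order \<open>n + 1\<close> by its border\<close>

lemma partial_perm_Suc_cases:
  assumes \<pi>: "partial_perm (Suc n) \<pi>"
  obtains "\<pi> = restr n \<pi>"
  | "\<pi> = place {(Suc n, Suc n)} (restr n \<pi>)"
  | i where "i \<in> zero_rows n (restr n \<pi>)" "\<pi> = place {(i, Suc n)} (restr n \<pi>)"
  | j where "j \<in> zero_cols n (restr n \<pi>)" "\<pi> = place {(Suc n, j)} (restr n \<pi>)"
  | i j where "i \<in> zero_rows n (restr n \<pi>)" "j \<in> zero_cols n (restr n \<pi>)"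
      "\<pi> = place {(i, Suc n), (Suc n, j)} (restr n \<pi>)"
proof -
  note P = partial_permD[OF \<pi>]
  have bd: "i \<le> n \<or> i = Suc n" "j \<le> n \<or> j = Suc n" if "\<pi> i j \<noteq> 0" for i j
    using P(2)[OF that] by auto
  have eq: "\<pi> = place X (restr n \<pi>)"
    if "\<And>i. (i, Suc n) \<in> X \<longleftrightarrow> \<pi> i (Suc n) \<noteq> 0" "\<And>j. (Suc n, j) \<in> X \<longleftrightarrow> \<pi> (Suc n) j \<noteq> 0"
      "\<And>i j. (i, j) \<in> X \<Longrightarrow> i = Suc n \<or> j = Suc n" for X
  proof (intro ext)
    fix i j
    show "\<pi> i j = place X (restr n \<pi>) i j"
      using that(1)[of i] that(2)[of j] that(3)[of i j] bd[of i j] P(1)[of i j]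
      unfolding place_def restr_def by (auto split: if_splits)
  qed
  \<comment> \<open>The 1 in column \<open>n + 1\<close> is the only one of its row, so cutting that
    column off leaves row \<open>i\<close> zero.\<close>
  have ZR: "i \<in> zero_rows n (restr n \<pi>)" if "\<pi> i (Suc n) \<noteq> 0" "i \<noteq> Suc n" for i
  proof -
    have "restr n \<pi> i j = 0" for j
      using P(3)[OF that(1), of j] by (cases "\<pi> i j = 0") (auto simp: restr_def)
    then show ?thesis
      using that P(2)[OF that(1)] by (auto simp: zero_rows_def)
  qed
  have ZC: "j \<in> zero_cols n (restr n \<pi>)" if "\<pi> (Suc n) j \<noteq> 0" "j \<noteq> Suc n" for j
  proof -
    have "restr n \<pi> i j = 0" for i
      using P(4)[OF that(1), of i] by (cases "\<pi> i j = 0") (auto simp: restr_def)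
    then show ?thesis
      using that P(2)[OF that(1)] by (auto simp: zero_cols_def)
  qed
  consider "\<forall>i. \<pi> i (Suc n) = 0" "\<forall>j. \<pi> (Suc n) j = 0"
    | "\<pi> (Suc n) (Suc n) \<noteq> 0"
    | i where "\<pi> i (Suc n) \<noteq> 0" "i \<noteq> Suc n" "\<forall>j. \<pi> (Suc n) j = 0"
    | j where "\<pi> (Suc n) j \<noteq> 0" "j \<noteq> Suc n" "\<forall>i. \<pi> i (Suc n) = 0"
    | i j where "\<pi> i (Suc n) \<noteq> 0" "i \<noteq> Suc n" "\<pi> (Suc n) j \<noteq> 0" "j \<noteq> Suc n"
    by metis
  then show ?thesis
  proof cases
    case 1
    then have "\<pi> = place {} (restr n \<pi>)" by (intro eq) auto
    then show ?thesis using that(1) by simp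
  next
    case 2
    have "\<pi> = place {(Suc n, Suc n)} (restr n \<pi>)"
      by (intro eq; simp del: neq0_conv; metis P(3,4) 2)
    then show ?thesis by (rule that(2))
  next
    case 3
    have "\<pi> = place {(i, Suc n)} (restr n \<pi>)"
      by (intro eq; simp del: neq0_conv; metis P(3,4) 3)
    then show ?thesis by (rule that(3)[OF ZR[OF 3(1,2)]])
  next
    case 4
    have "\<pi> = place {(Suc n, j)} (restr n \<pi>)"
      by (intro eq; simp del: neq0_conv; metis P(3,4) 4)
    then show ?thesis by (rule that(4)[OF ZC[OF 4(1,2)]])
  next
    case 5
    have "\<pi> = place {(i, Suc n), (Suc n, j)} (restr n \<pi>)"
      by (intro eq; simp del: neq0_conv; metis P(3,4) 5)
    then show ?thesis by (rule that(5)[OF ZR[OF 5(1,2)] ZC[OF 5(3,4)]])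
  qed
qed

section \<open>Unique parametrisation and the resulting split of sums\<close>

definition border :: "nat \<Rightarrow> (nat \<Rightarrow> nat \<Rightarrow> nat) \<Rightarrow> (nat \<times> nat) set" where
  "border n \<pi> = {(i, j). \<pi> i j = 1 \<and> (i = Suc n \<or> j = Suc n)}"

lemma border_place:
  assumes "partial_perm n \<pi>" "X \<subseteq> {Suc n} \<times> UNIV \<union> UNIV \<times> {Suc n}"
  shows "border n (place X \<pi>) = X"
  using assms(2) last_row_col_zero[OF assms(1)] by (auto simp: place_def border_def)

text \<open>\<open>restr\<close> recovers the matrix and \<open>border\<close> recovers the cells,
  so a bordered matrix determines both of its ingredients. This makes the parametrisation of each
  border type injective.\<close>

lemma place_cancel:
  assumes "partial_perm n \<pi>" "partial_perm n \<pi>'" "place X \<pi> = place Y \<pi>'"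
    and "X \<union> Y \<subseteq> {Suc n} \<times> UNIV \<union> UNIV \<times> {Suc n}"
  shows "\<pi> = \<pi>'" "X = Y"
proof -
  have "restr n (place X \<pi>) = \<pi>" by (rule restr_place) (use assms in auto)
  moreover have "restr n (place Y \<pi>') = \<pi>'" by (rule restr_place) (use assms in auto)
  ultimately show "\<pi> = \<pi>'" using assms(3) by simp
  show "X = Y"
    using border_place[OF assms(1), of X] border_place[OF assms(2), of Y] assms(3,4) by simp
qed

text \<open>The five summands are the border types: empty, corner, column only, row only, row and
  column. In the last one the sum over \<open>j\<close> is the outer one because the row that closes
  a cycle is later counted for fixed \<open>j\<close>.\<close>

lemma sum_partial_perms_Suc:
  fixes f :: "(nat \<Rightarrow> nat \<Rightarrow> nat) \<Rightarrow> 'a::comm_monoid_add"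
  shows "(\<Sum>\<pi>\<in>partial_perms (Suc n) k. f \<pi>) =
    (if k = 0 then 0 else \<Sum>\<pi>\<in>partial_perms n (k - 1). f \<pi>) +
    (\<Sum>\<pi>\<in>partial_perms n k. f (place {(Suc n, Suc n)} \<pi>)) +
    (\<Sum>\<pi>\<in>partial_perms n k. \<Sum>i\<in>zero_rows n \<pi>. f (place {(i, Suc n)} \<pi>)) +
    (\<Sum>\<pi>\<in>partial_perms n k. \<Sum>j\<in>zero_cols n \<pi>. f (place {(Suc n, j)} \<pi>)) +
    (\<Sum>\<pi>\<in>partial_perms n (Suc k). \<Sum>j\<in>zero_cols n \<pi>. \<Sum>i\<in>zero_rows n \<pi>.
       f (place {(i, Suc n), (Suc n, j)} \<pi>))"
proof -
  let ?N = "Suc n" and ?P = "partial_perms n"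
  \<comment> \<open>For \<open>k = 0\<close> this class is empty, since an appended zero row forces
    at least one. The guard also keeps the truncated \<open>k - 1\<close> from meaning 0.\<close>
  define A1 where "A1 = (if k = 0 then {} else ?P (k - 1))"
  define A2 where "A2 = place {(?N, ?N)} ` ?P k"
  define S3 where "S3 = Sigma (?P k) (zero_rows n)"
  define g3 where "g3 = (\<lambda>(\<pi>, i). place {(i, ?N)} \<pi>)"
  define S4 where "S4 = Sigma (?P k) (zero_cols n)"
  define g4 where "g4 = (\<lambda>(\<pi>, j). place {(?N, j)} \<pi>)"
  define S5 where "S5 = Sigma (?P (Suc k)) (\<lambda>\<pi>. zero_cols n \<pi> \<times> zero_rows n \<pi>)"
  define g5 where "g5 = (\<lambda>(\<pi>, j, i). place {(i, ?N), (?N, j)} \<pi>)"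
  note defs = A1_def A2_def S3_def g3_def S4_def g4_def S5_def g5_def
  have P: "partial_perm n \<pi>" if "\<pi> \<in> ?P l" for \<pi> l
    using that by (simp add: partial_perms_iff)
  have eq: "partial_perms ?N k = A1 \<union> A2 \<union> g3 ` S3 \<union> g4 ` S4 \<union> g5 ` S5"
  proof (intro equalityI subsetI)
    fix \<pi> assume \<pi>: "\<pi> \<in> partial_perms ?N k"
    define \<sigma> where "\<sigma> = restr n \<pi>"
    define l where "l = card (zero_rows n \<sigma>)"
    have pp: "partial_perm ?N \<pi>" using \<pi> by (simp add: partial_perms_iff)
    have \<sigma>: "\<sigma> \<in> ?P l"
      using partial_perm_restr[OF pp] by (simp add: partial_perms_iff l_def \<sigma>_def)
    from pp show "\<pi> \<in> A1 \<union> A2 \<union> g3 ` S3 \<union> g4 ` S4 \<union> g5 ` S5"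
    proof (cases rule: partial_perm_Suc_cases)
      case 1
      note 1 = 1[folded \<sigma>_def]
      have "\<pi> \<in> A1" using 1 \<pi> \<sigma> partial_perms_empty[OF \<sigma>, of k] by (simp add: A1_def)
      then show ?thesis by blast
    next
      case 2
      note 2 = 2[folded \<sigma>_def]
      have "\<pi> \<in> A2" using 2 \<pi> \<sigma> partial_perms_corner[OF \<sigma>, of k] by (auto simp: A2_def)
      then show ?thesis by blast
    next
      case (3 i)
      note 3 = 3[folded \<sigma>_def]
      have "\<pi> = g3 (\<sigma>, i)" "(\<sigma>, i) \<in> S3"
        using 3 \<pi> \<sigma> partial_perms_col[OF \<sigma> 3(1), of k] by (auto simp: S3_def g3_def 3)
      then show ?thesis by blast
    next
      case (4 j)
      note 4 = 4[folded \<sigma>_def]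
      have "\<pi> = g4 (\<sigma>, j)" "(\<sigma>, j) \<in> S4"
        using 4 \<pi> \<sigma> partial_perms_row[OF \<sigma> 4(1), of k] by (auto simp: S4_def g4_def)
      then show ?thesis by blast
    next
      case (5 i j)
      note 5 = 5[folded \<sigma>_def]
      have "\<pi> = g5 (\<sigma>, j, i)" "(\<sigma>, j, i) \<in> S5"
        using 5 \<pi> \<sigma> partial_perms_row_col[OF \<sigma> 5(1,2), of k] by (auto simp: S5_def g5_def)
      then show ?thesis by blast
    qed
  next
    fix \<pi> assume "\<pi> \<in> A1 \<union> A2 \<union> g3 ` S3 \<union> g4 ` S4 \<union> g5 ` S5"
    then show "\<pi> \<in> partial_perms ?N k"
      by (auto simp: defs partial_perms_empty partial_perms_corner partial_perms_col
          partial_perms_row partial_perms_row_col split: if_splits)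
  qed
  have inj2: "inj_on (place {(?N, ?N)}) (?P k)"
    by (rule inj_onI, drule P, drule P, erule (2) place_cancel(1)) auto
  have inj3: "inj_on g3 S3"
  proof (rule inj_onI, clarify)
    fix \<pi> i \<pi>' i' assume "(\<pi>, i) \<in> S3" "(\<pi>', i') \<in> S3" "g3 (\<pi>, i) = g3 (\<pi>', i')"
    with place_cancel[of n \<pi> \<pi>' "{(i, ?N)}" "{(i', ?N)}"]
    show "\<pi> = \<pi>' \<and> i = i'" by (auto simp: S3_def g3_def dest: P)
  qed
  have inj4: "inj_on g4 S4"
  proof (rule inj_onI, clarify)
    fix \<pi> j \<pi>' j' assume "(\<pi>, j) \<in> S4" "(\<pi>', j') \<in> S4" "g4 (\<pi>, j) = g4 (\<pi>', j')"
    with place_cancel[of n \<pi> \<pi>' "{(?N, j)}" "{(?N, j')}"]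
    show "\<pi> = \<pi>' \<and> j = j'" by (auto simp: S4_def g4_def dest: P)
  qed
  have inj5: "inj_on g5 S5"
  proof (rule inj_onI)
    fix x y assume xy: "x \<in> S5" "y \<in> S5" "g5 x = g5 y"
    obtain \<pi> j i where x: "x = (\<pi>, j, i)" by (rule prod_cases3)
    obtain \<pi>' j' i' where y: "y = (\<pi>', j', i')" by (rule prod_cases3)
    note * = xy[unfolded x y]
    from * have ne: "i \<noteq> ?N" "j \<noteq> ?N" "i' \<noteq> ?N" "j' \<noteq> ?N" "partial_perm n \<pi>" "partial_perm n \<pi>'"
      by (auto simp: S5_def dest: P)
    have "\<pi> = \<pi>'" "{(i, ?N), (?N, j)} = {(i', ?N), (?N, j')}"
      using place_cancel[OF ne(5,6), of "{(i, ?N), (?N, j)}" "{(i', ?N), (?N, j')}"] *(3)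
      by (simp_all add: g5_def)
    \<comment> \<open>All four indices differ from \<open>n + 1\<close>, so a cell of the last
      column cannot be mistaken for one of the last row, and the two-element sets agree cell by
      cell.\<close>
    with ne show "x = y" by (auto simp: x y doubleton_eq_iff)
  qed
  have b1: "border n \<pi> = {}" if "\<pi> \<in> A1" for \<pi>
    using that border_place[of n \<pi> "{}"] by (auto simp: A1_def dest: P split: if_splits)
  have b2: "border n \<pi> = {(?N, ?N)}" if "\<pi> \<in> A2" for \<pi>
    using that by (auto simp: A2_def border_place P)
  have b3: "\<exists>i\<le>n. border n \<pi> = {(i, ?N)}" if "\<pi> \<in> g3 ` S3" for \<pi>
    using that by (auto simp: S3_def g3_def border_place P zero_rows_def)
  have b4: "\<exists>j\<le>n. border n \<pi> = {(?N, j)}" if "\<pi> \<in> g4 ` S4" for \<pi>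
    using that by (auto simp: S4_def g4_def border_place P zero_cols_def)
  have b5: "\<exists>i\<le>n. \<exists>j\<le>n. border n \<pi> = {(i, ?N), (?N, j)}" if "\<pi> \<in> g5 ` S5" for \<pi>
  proof -
    from that obtain \<sigma> i j where "\<pi> = place {(i, ?N), (?N, j)} \<sigma>" "\<sigma> \<in> ?P (Suc k)" "i \<le> n" "j \<le> n"
      by (auto simp: S5_def g5_def zero_rows_def zero_cols_def)
    then show ?thesis by (intro exI[of _ i] exI[of _ j]) (auto simp: border_place P)
  qed
  \<comment> \<open>Two flags, for a 1 in the new row and in the new column away from the corner,
    separate the border types; the corner cell separates the remaining pair \<open>A1\<close> and
    \<open>A2\<close>.\<close>
  define row where "row \<pi> \<longleftrightarrow> (\<exists>j\<le>n. (?N, j) \<in> border n \<pi>)" for \<pi>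
  define col where "col \<pi> \<longleftrightarrow> (\<exists>i\<le>n. (i, ?N) \<in> border n \<pi>)" for \<pi>
  have c1: "\<not> row \<pi> \<and> \<not> col \<pi> \<and> (?N, ?N) \<notin> border n \<pi>" if "\<pi> \<in> A1" for \<pi>
    by (simp add: row_def col_def b1[OF that])
  have c2: "\<not> row \<pi> \<and> \<not> col \<pi> \<and> (?N, ?N) \<in> border n \<pi>" if "\<pi> \<in> A2" for \<pi>
    by (simp add: row_def col_def b2[OF that])
  have c3: "\<not> row \<pi> \<and> col \<pi>" if "\<pi> \<in> g3 ` S3" for \<pi>
  proof -
    note b = b3[OF that]
    obtain i where "i \<le> n" "border n \<pi> = {(i, ?N)}" using b by blast
    then show ?thesis by (simp add: row_def col_def)
  qed
  have c4: "row \<pi> \<and> \<not> col \<pi>" if "\<pi> \<in> g4 ` S4" for \<pi>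
  proof -
    note b = b4[OF that]
    obtain j where "j \<le> n" "border n \<pi> = {(?N, j)}" using b by blast
    then show ?thesis by (simp add: row_def col_def)
  qed
  have c5: "row \<pi> \<and> col \<pi>" if "\<pi> \<in> g5 ` S5" for \<pi>
  proof -
    note b = b5[OF that]
    obtain i j where "i \<le> n" "j \<le> n" "border n \<pi> = {(i, ?N), (?N, j)}"
      using b by blast
    then show ?thesis by (auto simp: row_def col_def)
  qed
  have d5: "(A1 \<union> A2 \<union> g3 ` S3 \<union> g4 ` S4) \<inter> g5 ` S5 = {}"
    and d4: "(A1 \<union> A2 \<union> g3 ` S3) \<inter> g4 ` S4 = {}"
    and d3: "(A1 \<union> A2) \<inter> g3 ` S3 = {}"
    and d2: "A1 \<inter> A2 = {}"
    using c1 c2 c3 c4 c5 by blast+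
  have fin: "finite A1" "finite A2" "finite S3" "finite S4" "finite S5"
    by (auto simp: defs finite_partial_perms)
  have "sum f (partial_perms ?N k) =
      sum f A1 + sum f A2 + sum f (g3 ` S3) + sum f (g4 ` S4) + sum f (g5 ` S5)"
    unfolding eq using fin by (simp add: sum.union_disjoint d2 d3 d4 d5)
  also have "sum f A1 = (if k = 0 then 0 else sum f (?P (k - 1)))"
    by (simp add: A1_def)
  also have "sum f A2 = (\<Sum>\<pi>\<in>?P k. f (place {(?N, ?N)} \<pi>))"
    unfolding A2_def by (simp add: sum.reindex[OF inj2])
  also have "sum f (g3 ` S3) = (\<Sum>\<pi>\<in>?P k. \<Sum>i\<in>zero_rows n \<pi>. f (place {(i, ?N)} \<pi>))"
    unfolding sum.reindex[OF inj3] unfolding S3_def g3_def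
    by (subst sum.Sigma) (simp_all add: finite_partial_perms case_prod_unfold)
  also have "sum f (g4 ` S4) = (\<Sum>\<pi>\<in>?P k. \<Sum>j\<in>zero_cols n \<pi>. f (place {(?N, j)} \<pi>))"
    unfolding sum.reindex[OF inj4] unfolding S4_def g4_def
    by (subst sum.Sigma) (simp_all add: finite_partial_perms case_prod_unfold)
  also have "sum f (g5 ` S5) = (\<Sum>\<pi>\<in>?P (Suc k). \<Sum>j\<in>zero_cols n \<pi>. \<Sum>i\<in>zero_rows n \<pi>.
       f (place {(i, ?N), (?N, j)} \<pi>))"
    unfolding sum.reindex[OF inj5] unfolding S5_def g5_def
    by (simp add: sum.Sigma finite_partial_perms case_prod_unfold sum.cartesian_product)
  finally show ?thesis .
qed

subsection \<open>Locality of the statistics\<close>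

text \<open>Equal numbers of zero rows and zero columns mean that without zero rows every line
  contains a 1, and it is unique in any partial permutation. At the last index this turns strength
  of a fixed point or cycle into \<open>k = 0\<close>.\<close>

lemma leading_perm_iff_zero_rows:
  assumes "partial_perm n \<pi>"
  shows "leading_perm \<pi> n \<longleftrightarrow> zero_rows n \<pi> = {}"
proof
  assume L: "leading_perm \<pi> n"
  have "\<exists>c. \<pi> r c \<noteq> 0" if "r \<in> {1..n}" for r
  proof -
    have "\<exists>!c. c \<in> {1..n} \<and> \<pi> r c = 1"
      using L that unfolding leading_perm_def by blast
    then obtain c where "\<pi> r c = 1" by blast
    then show ?thesis by (intro exI[of _ c]) simp
  qed
  then show "zero_rows n \<pi> = {}"
    by (auto simp: zero_rows_def simp del: neq0_conv)
next
  assume R: "zero_rows n \<pi> = {}"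
  then have C: "zero_cols n \<pi> = {}"
    using card_zero_cols[OF assms] by simp
  note P = partial_permD[OF assms]
  have "\<exists>!c. c \<in> {1..n} \<and> \<pi> r c = 1" if "r \<in> {1..n}" for r
  proof -
    obtain c where "\<pi> r c \<noteq> 0" using R \<open>r \<in> {1..n}\<close> by (auto simp: zero_rows_def)
    then have "c \<in> {1..n} \<and> \<pi> r c = 1" using P(1)[of r c] P(2)[of r c] by simp
    then show ?thesis using P(3)[of r c] by (metis zero_neq_one)
  qed
  moreover have "\<exists>!r. r \<in> {1..n} \<and> \<pi> r c = 1" if "c \<in> {1..n}" for c
  proof -
    obtain r where "\<pi> r c \<noteq> 0" using C \<open>c \<in> {1..n}\<close> by (auto simp: zero_cols_def)
    then have "r \<in> {1..n} \<and> \<pi> r c = 1" using P(1)[of r c] P(2)[of r c] by simp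
    then show ?thesis using P(4)[of r c] by (metis zero_neq_one)
  qed
  ultimately show "leading_perm \<pi> n"
    unfolding leading_perm_def using P(1) by blast
qed

lemma leading_perm_restr: "i \<le> n \<Longrightarrow> leading_perm (restr n \<pi>) i \<longleftrightarrow> leading_perm \<pi> i"
  unfolding leading_perm_def restr_def by (simp cong: conj_cong)

lemma full_cycle_finite: "full_cycle \<pi> C \<Longrightarrow> finite C \<and> C \<noteq> {}"
  by (auto simp: full_cycle_def)

text \<open>Each member of a cycle is the row of one of its steps, so nonzero entries of the
  restriction confine the whole cycle to \<open>{..n}\<close>.\<close>

lemma full_cycle_restr: "full_cycle (restr n \<pi>) C \<longleftrightarrow> full_cycle \<pi> C \<and> C \<subseteq> {..n}"
proof
  assume "full_cycle (restr n \<pi>) C"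
  then obtain xs where xs: "xs \<noteq> []" "distinct xs" "set xs = C"
    "\<And>m. m < length xs \<Longrightarrow> restr n \<pi> (xs ! m) (xs ! ((m + 1) mod length xs)) = 1"
    unfolding full_cycle_def by blast
  have "xs ! m \<le> n \<and> \<pi> (xs ! m) (xs ! ((m + 1) mod length xs)) = 1" if "m < length xs" for m
    using xs(4)[OF that] by (auto simp: restr_def split: if_splits)
  then show "full_cycle \<pi> C \<and> C \<subseteq> {..n}"
    unfolding full_cycle_def using xs(1-3) by (auto simp: in_set_conv_nth)
next
  assume "full_cycle \<pi> C \<and> C \<subseteq> {..n}"
  then obtain xs where xs: "xs \<noteq> []" "distinct xs" "set xs = C" "C \<subseteq> {..n}"
    "\<And>m. m < length xs \<Longrightarrow> \<pi> (xs ! m) (xs ! ((m + 1) mod length xs)) = 1"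
    unfolding full_cycle_def by blast
  have "xs ! m \<le> n" if "m < length xs" for m
    using that xs(3,4) nth_mem by blast
  then show "full_cycle (restr n \<pi>) C"
    unfolding full_cycle_def using xs by (intro exI[of _ xs]) (auto simp: restr_def)
qed

text \<open>A cycle with maximum \<open>i\<close> lies in \<open>{..i}\<close> and is therefore seen
  completely by the restriction.\<close>

lemma Cyc_restr: "i \<le> n \<Longrightarrow> i \<in> Cyc (restr n \<pi>) \<longleftrightarrow> i \<in> Cyc \<pi>"
proof -
  assume i: "i \<le> n"
  have "C \<subseteq> {..n}" if "full_cycle \<pi> C" "i = Max C" for C
    using full_cycle_finite[OF that(1)] that(2) i by (auto intro: order_trans[OF Max_ge])
  then show ?thesis
    unfolding Cyc_def mem_Collect_eq full_cycle_restr by blast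
qed

text \<open>Strength depends on a cycle only through its maximum, so it can be separated from the
  choice of the cycle.\<close>

lemma Scyc_iff: "i \<in> Scyc \<pi> \<longleftrightarrow> i \<in> Cyc \<pi> \<and> leading_perm \<pi> i"
  by (auto simp: Scyc_def Cyc_def strong_cycle_def)

lemma Fix_restr: "i \<le> n \<Longrightarrow> i \<in> Fix (restr n \<pi>) \<longleftrightarrow> i \<in> Fix \<pi>"
  by (simp add: Fix_def restr_def)

lemma Excl_restr: "i \<le> n \<Longrightarrow> i \<in> Excl (restr n \<pi>) \<longleftrightarrow> i \<in> Excl \<pi>"
  unfolding Excl_def restr_def mem_Collect_eq by (intro ex_cong) auto

lemma Sfix_iff: "i \<in> Sfix \<pi> \<longleftrightarrow> i \<in> Fix \<pi> \<and> leading_perm \<pi> i"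
  by (simp add: Sfix_def Fix_def)

text \<open>What has to be excluded is a 1 of row \<open>i\<close> in a column beyond
  \<open>n\<close>, which the restriction would delete. A right-to-left minimum keeps its column
  inside the leading square of order \<open>i\<close>.\<close>

lemma Rlmip_restr:
  assumes "partial_perm m \<pi>" "i \<le> n"
  shows "i \<in> Rlmip (restr n \<pi>) \<longleftrightarrow> i \<in> Rlmip \<pi>"
proof -
  note P = partial_permD[OF assms(1)]
  \<comment> \<open>The \<open>j - 1\<close> ones in the columns before \<open>j\<close> lie in distinct rows above row \<open>i\<close>, so \<open>j \<le> i\<close>.\<close>
  have le: "j \<le> n" if one: "\<pi> i j = 1" and left: "\<forall>c. 1 \<le> c \<and> c < j \<longrightarrow> (\<exists>r<i. \<pi> r c = 1)" for j
  proof -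
    obtain r where r: "\<And>c. 1 \<le> c \<Longrightarrow> c < j \<Longrightarrow> r c < i \<and> \<pi> (r c) c = 1"
      using left by metis
    have "inj_on r {1..<j}"
    proof (rule inj_onI)
      fix c c' assume "c \<in> {1..<j}" "c' \<in> {1..<j}" "r c = r c'"
      then show "c = c'" using r[of c] r[of c'] P(3)[of "r c" c c'] by simp
    qed
    moreover have "r ` {1..<j} \<subseteq> {1..<i}"
    proof clarify
      fix c assume "c \<in> {1..<j}"
      then show "r c \<in> {1..<i}" using r[of c] P(2)[of "r c" c] by simp
    qed
    ultimately have "card {1..<j} \<le> card {1..<i}"
      by (intro card_inj_on_le) auto
    moreover have "i \<ge> 1" using P(2)[of i j] one by simp
    ultimately show ?thesis using assms(2) by simp
  qed
  have "restr n \<pi> i j = 1 \<and> (\<forall>c. 1 \<le> c \<and> c < j \<longrightarrow> (\<exists>r<i. restr n \<pi> r c = 1)) \<longleftrightarrow>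
    \<pi> i j = 1 \<and> (\<forall>c. 1 \<le> c \<and> c < j \<longrightarrow> (\<exists>r<i. \<pi> r c = 1))" for j
  proof (cases "j \<le> n")
    case True
    have "r < i \<and> restr n \<pi> r c = 1 \<longleftrightarrow> r < i \<and> \<pi> r c = 1" if "c < j" for r c
      using that True assms(2) by (auto simp: restr_def)
    moreover have "restr n \<pi> i j = \<pi> i j"
      using True assms(2) by (simp add: restr_def)
    ultimately show ?thesis by (metis (no_types, lifting))
  next
    case False
    then show ?thesis using le[of j] by (auto simp: restr_def)
  qed
  then show ?thesis unfolding Rlmip_def by simp
qed

text \<open>The rows above row \<open>n + 1\<close> make up the whole old matrix, so a column left
  of \<open>j\<close> has a 1 above exactly when it is not an old zero column. The corner
  \<open>j = n + 1\<close> is included.\<close>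

lemma last_in_Rlmip_iff:
  assumes \<pi>: "partial_perm (Suc n) \<pi>" and j: "\<pi> (Suc n) j = 1"
  shows "Suc n \<in> Rlmip \<pi> \<longleftrightarrow> (\<forall>c\<in>zero_cols n (restr n \<pi>). j \<le> c)"
proof -
  note P = partial_permD[OF \<pi>]
  have jN: "j \<le> Suc n" using P(2)[of "Suc n" j] j by simp
  have "(\<exists>r<Suc n. \<pi> r c = 1) \<longleftrightarrow> c \<notin> zero_cols n (restr n \<pi>)" if "1 \<le> c" "c < j" for c
  proof -
    have "restr n \<pi> r c \<noteq> 0 \<longleftrightarrow> r < Suc n \<and> \<pi> r c = 1" for r
      using that jN P(1)[of r c] by (auto simp: restr_def)
    then have "(\<exists>r<Suc n. \<pi> r c = 1) \<longleftrightarrow> (\<exists>r. restr n \<pi> r c \<noteq> 0)"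
      by simp
    then show ?thesis using that jN by (auto simp: zero_cols_def)
  qed
  then have "(\<forall>c. 1 \<le> c \<and> c < j \<longrightarrow> (\<exists>r<Suc n. \<pi> r c = 1)) \<longleftrightarrow>
      (\<forall>c\<in>zero_cols n (restr n \<pi>). j \<le> c)"
    by (auto simp: zero_cols_def not_less)
  moreover have "j' = j" if "\<pi> (Suc n) j' = 1" for j'
    using P(3)[of "Suc n" j j'] j that by simp
  ultimately show ?thesis
    unfolding Rlmip_def using j by blast
qed

subsection \<open>Cycles through the last element\<close>

text \<open>The cyclic step condition survives rotation of the list, so any member can be moved to
  index 0.\<close>

lemma full_cycle_rotate:
  assumes "full_cycle \<pi> C" "x \<in> C"
  obtains xs where "distinct xs" "set xs = C" "xs \<noteq> []" "xs ! 0 = x"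
    "\<And>m. m < length xs \<Longrightarrow> \<pi> (xs ! m) (xs ! ((m + 1) mod length xs)) = 1"
proof -
  obtain ys where ys: "ys \<noteq> []" "distinct ys" "set ys = C"
    "\<And>m. m < length ys \<Longrightarrow> \<pi> (ys ! m) (ys ! ((m + 1) mod length ys)) = 1"
    using assms(1) unfolding full_cycle_def by blast
  obtain q where q: "q < length ys" "ys ! q = x"
    using assms(2) ys(3) by (auto simp: in_set_conv_nth)
  let ?xs = "rotate q ys"
  have nth: "?xs ! m = ys ! ((q + m) mod length ys)" if "m < length ys" for m
    using that by (rule nth_rotate)
  show ?thesis
  proof (rule that)
    show "distinct ?xs" "set ?xs = C" "?xs \<noteq> []" using ys by simp_all
    show "?xs ! 0 = x" using nth[of 0] ys(1) q by simp
    fix m assume "m < length ?xs"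
    then have m: "m < length ys" by simp
    have "ys ! (((q + m) mod length ys + 1) mod length ys) = ?xs ! ((m + 1) mod length ys)"
      using nth[of "(m + 1) mod length ys"] ys(1) by (simp add: mod_simps)
    then show "\<pi> (?xs ! m) (?xs ! ((m + 1) mod length ?xs)) = 1"
      using ys(4)[of "(q + m) mod length ys"] nth[OF m] ys(1) by simp
  qed
qed

lemma full_cycle_row_col:
  assumes "full_cycle \<pi> C" "x \<in> C"
  shows "\<exists>j. \<pi> x j = 1" "\<exists>i. \<pi> i x = 1"
proof -
  obtain xs where xs: "xs \<noteq> []" "xs ! 0 = x"
    "\<And>m. m < length xs \<Longrightarrow> \<pi> (xs ! m) (xs ! ((m + 1) mod length xs)) = 1"
    using full_cycle_rotate[OF assms] by metis
  show "\<exists>j. \<pi> x j = 1" using xs(3)[of 0] xs(1,2) by auto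
  have "\<pi> (xs ! (length xs - 1)) x = 1"
    using xs(3)[of "length xs - 1"] xs(1,2) by simp
  then show "\<exists>i. \<pi> i x = 1" ..
qed

lemma full_cycle_subset:
  assumes "partial_perm n \<pi>" "full_cycle \<pi> C"
  shows "C \<subseteq> {1..n}"
proof
  fix x assume "x \<in> C"
  then obtain j where "\<pi> x j = 1" using full_cycle_row_col(1)[OF assms(2)] by blast
  then show "x \<in> {1..n}" using partial_permD(2)[OF assms(1), of x j] by simp
qed

lemma CycE:
  assumes "i \<in> Cyc \<pi>"
  obtains C where "full_cycle \<pi> C" "i \<in> C" "i = Max C"
proof -
  obtain C where C: "full_cycle \<pi> C" "i = Max C"
    using assms unfolding Cyc_def by blast
  then have "i \<in> C"
    using full_cycle_finite[of \<pi> C] by simp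
  with C show ?thesis by (intro that)
qed

lemma Cyc_row_col: "i \<in> Cyc \<pi> \<Longrightarrow> (\<exists>j. \<pi> i j = 1) \<and> (\<exists>j. \<pi> j i = 1)"
  by (erule CycE) (blast dest: full_cycle_row_col)

text \<open>Deleting \<open>n + 1\<close> from a cycle through it leaves a path in the old matrix
  from its successor \<open>j\<close> to its predecessor \<open>i\<close>; inserting it closes such
  a path. No index exceeds \<open>n + 1\<close>, so it is the maximum of any cycle that contains
  it.\<close>

lemma last_in_Cyc_iff:
  assumes \<pi>: "partial_perm (Suc n) \<pi>" and i: "\<pi> i (Suc n) = 1" "i \<le> n"
    and j: "\<pi> (Suc n) j = 1" "j \<le> n"
  shows "Suc n \<in> Cyc \<pi> \<longleftrightarrow> (\<lambda>x y. restr n \<pi> x y = 1)\<^sup>*\<^sup>* j i" (is "_ \<longleftrightarrow> ?r\<^sup>*\<^sup>* j i")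
proof
  note P = partial_permD[OF \<pi>]
  assume "Suc n \<in> Cyc \<pi>"
  then obtain C where C: "full_cycle \<pi> C" "Suc n \<in> C" by (rule CycE)
  obtain xs where xs: "distinct xs" "set xs = C" "xs \<noteq> []" "xs ! 0 = Suc n"
    "\<And>m. m < length xs \<Longrightarrow> \<pi> (xs ! m) (xs ! ((m + 1) mod length xs)) = 1"
    using full_cycle_rotate[OF C] by metis
  let ?l = "length xs"
  have next_j: "xs ! (1 mod ?l) = j"
    using xs(5)[of 0] xs(3,4) P(3)[of "Suc n" j "xs ! (1 mod ?l)"] j by simp
  \<comment> \<open>A one-element cycle would make \<open>n + 1\<close> its own successor, whereas
    \<open>j\<close> is at most \<open>n\<close>.\<close>
  have l: "1 < ?l"
  proof (rule ccontr)
    assume "\<not> 1 < ?l"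
    with xs(3) have "?l = 1" by (cases xs) auto
    then show False using next_j xs(4) j(2) by simp
  qed
  \<comment> \<open>By distinctness \<open>n + 1\<close> occurs only at index 0, so the steps among
    the other members survive the restriction.\<close>
  have le: "xs ! q \<le> n" if "0 < q" "q < ?l" for q
  proof -
    have "xs ! q \<noteq> xs ! 0" using xs(1) that by (subst nth_eq_iff_index_eq) auto
    moreover have "xs ! q \<in> {1..Suc n}"
      using full_cycle_subset[OF \<pi> C(1)] xs(2) that nth_mem by blast
    ultimately show ?thesis using xs(4) by simp
  qed
  have path: "?r\<^sup>*\<^sup>* j (xs ! Suc q)" if "Suc q < ?l" for q
    using that
  proof (induction q)
    case 0
    then show ?case using next_j l by simp
  next
    case (Suc q)
    then have "?r (xs ! Suc q) (xs ! Suc (Suc q))"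
      using xs(5)[of "Suc q"] le[of "Suc q"] le[of "Suc (Suc q)"] by (simp add: restr_def)
    then show ?case using Suc by (simp add: rtranclp.rtrancl_into_rtrancl)
  qed
  have "\<pi> (xs ! (?l - 1)) (Suc n) = 1"
    using xs(5)[of "?l - 1"] xs(3,4) by simp
  then have "xs ! (?l - 1) = i" using i P(4)[of i "Suc n" "xs ! (?l - 1)"] by simp
  then show "?r\<^sup>*\<^sup>* j i" using path[of "?l - 2"] l by (simp add: Suc_diff_Suc numeral_2_eq_2)
next
  assume "?r\<^sup>*\<^sup>* j i"
  \<comment> \<open>The list form of a path allows loops to be cut out, as the cycle list must be
    distinct. The path list omits its starting point, hence \<open>j # ys\<close>.\<close>
  then obtain zs where "rtrancl_path ?r j zs i" by (auto simp: rtranclp_eq_rtrancl_path)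
  then obtain ys where ys: "rtrancl_path ?r j ys i" "distinct (j # ys)"
    by (rule rtrancl_path_distinct)
  have le: "y \<le> n" if "y \<in> set (j # ys)" for y
    using that j(2) rtrancl_path_Range[OF ys(1), of y] by (auto simp: restr_def split: if_splits)
  have last: "(j # ys) ! length ys = i"
    using ys(1) rtrancl_path_last[OF ys(1)]
    by (cases "ys = []") (auto simp: nth_Cons' last_conv_nth elim: rtrancl_path.cases)
  define xs where "xs = Suc n # j # ys"
  have "distinct xs" using ys(2) le[of "Suc n"] by (auto simp: xs_def)
  moreover have "\<pi> (xs ! m) (xs ! ((m + 1) mod length xs)) = 1" if "m < length xs" for m
  proof -
    \<comment> \<open>Three kinds of steps: from \<open>n + 1\<close> to \<open>j\<close>, the
      wrap-around from \<open>i\<close> to \<open>n + 1\<close>, and the steps of the path.\<close>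
    have "m = 0 \<or> m = Suc (length ys) \<or> (\<exists>q. m = Suc q \<and> q < length ys)"
      using that by (cases m) (auto simp: xs_def)
    then consider "m = 0" | "m = Suc (length ys)" | q where "m = Suc q" "q < length ys"
      by blast
    then show ?thesis
    proof cases
      case 1
      then show ?thesis using j by (simp add: xs_def)
    next
      case 2
      then show ?thesis using i last by (simp add: xs_def)
    next
      case 3
      then show ?thesis using rtrancl_path_nth[OF ys(1) 3(2)]
        by (simp add: xs_def restr_def split: if_splits)
    qed
  qed
  ultimately have fc: "full_cycle \<pi> (set xs)"
    unfolding full_cycle_def by (intro exI[of _ xs]) (auto simp: xs_def)
  have "Max (set xs) = Suc n"
    using le by (intro Max_eqI) (auto simp: xs_def intro: le_SucI)
  then show "Suc n \<in> Cyc \<pi>"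
    using fc unfolding Cyc_def by (metis (mono_tags, lifting) mem_Collect_eq)
qed

text \<open>Each row has at most one 1, so the walk from \<open>j\<close> is forced and can stop at
  one place only. It does stop: steps are injective and nothing maps to \<open>j\<close>, so within
  the finite index set it cannot go on forever.\<close>

lemma ex1_path_end:
  assumes \<pi>: "partial_perm n \<pi>" and j: "j \<in> zero_cols n \<pi>"
  shows "\<exists>!i. i \<in> zero_rows n \<pi> \<and> (\<lambda>x y. \<pi> x y = 1)\<^sup>*\<^sup>* j i" (is "\<exists>!i. _ \<and> ?r\<^sup>*\<^sup>* j i")
proof (rule ex_ex1I)
  note P = partial_permD[OF \<pi>]
  define S where "S = {x. ?r\<^sup>*\<^sup>* j x}"
  show "\<exists>i. i \<in> zero_rows n \<pi> \<and> ?r\<^sup>*\<^sup>* j i"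
  proof (rule ccontr)
    assume no: "\<nexists>i. i \<in> zero_rows n \<pi> \<and> ?r\<^sup>*\<^sup>* j i"
    have sub: "S \<subseteq> {1..n}"
    proof
      fix x assume "x \<in> S"
      then have "?r\<^sup>*\<^sup>* j x" by (simp add: S_def)
      then show "x \<in> {1..n}"
      proof cases
        case rtrancl_refl
        then show ?thesis using j by (simp add: zero_cols_def)
      next
        case (rtrancl_into_rtrancl y)
        then show ?thesis using P(2)[of y x] by simp
      qed
    qed
    have "\<exists>y. ?r x y" if "x \<in> S" for x
    proof -
      have "x \<in> {1..n}" "x \<notin> zero_rows n \<pi>" using sub no that by (auto simp: S_def)
      then obtain y where "\<pi> x y \<noteq> 0" by (auto simp: zero_rows_def)
      then show ?thesis using P(1)[of x y] by auto
    qed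
    then obtain f where f: "\<And>x. x \<in> S \<Longrightarrow> ?r x (f x)" by metis
    \<comment> \<open>An injective successor map on the finite set \<open>S\<close> would give the zero column \<open>j\<close> a preimage.\<close>
    have "f ` S \<subseteq> S"
      using f by (auto simp: S_def intro: rtranclp.rtrancl_into_rtrancl)
    moreover have "inj_on f S"
    proof (rule inj_onI)
      fix x y assume "x \<in> S" "y \<in> S" "f x = f y"
      then show "x = y" using f[of x] f[of y] P(4)[of x "f x" y] by simp
    qed
    ultimately have "f ` S = S"
      using finite_subset[OF sub finite_atLeastAtMost] by (intro endo_inj_surj)
    moreover have "j \<in> S" by (simp add: S_def)
    ultimately obtain x where "x \<in> S" "j = f x" by blast
    then show False using f[of x] j by (simp add: zero_cols_def)
  qed
  \<comment> \<open>Every point reached from \<open>j\<close> still leads to \<open>i\<close>: its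
    only outgoing step is the first step of its path to \<open>i\<close>, and \<open>i\<close>
    itself has none. Applied to \<open>i'\<close>, whose row is zero too, this leaves only the
    trivial path.\<close>
  fix i i' assume i: "i \<in> zero_rows n \<pi> \<and> ?r\<^sup>*\<^sup>* j i" and i': "i' \<in> zero_rows n \<pi> \<and> ?r\<^sup>*\<^sup>* j i'"
  have "?r\<^sup>*\<^sup>* x i" if "?r\<^sup>*\<^sup>* j x" for x
    using that
  proof induction
    case base
    then show ?case using i by simp
  next
    case (step x y)
    from step(3) show ?case
    proof (cases rule: converse_rtranclpE)
      case base
      then show ?thesis using step(2) i by (simp add: zero_rows_def)
    next
      case (step z)
      then show ?thesis using \<open>?r x y\<close> P(3)[of x y z] by simp
    qed
  qed
  with i' have "?r\<^sup>*\<^sup>* i' i" by simp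
  then show "i = i'"
  proof (cases rule: converse_rtranclpE)
    case (step z)
    then show ?thesis using i' by (simp add: zero_rows_def)
  qed simp
qed

lemma sum_if_unique:
  fixes c :: "'a::comm_ring_1"
  assumes "finite S" "\<exists>!x. x \<in> S \<and> Q x"
  shows "(\<Sum>x\<in>S. if Q x then c else 1) = of_nat (card S) - 1 + c"
proof -
  obtain x where x: "x \<in> S" "Q x" and uniq: "\<And>y. y \<in> S \<Longrightarrow> Q y \<Longrightarrow> y = x"
    using assms(2) by blast
  have "(\<Sum>y\<in>S. if Q y then c else 1) = c + (\<Sum>y\<in>S - {x}. if Q y then c else 1)"
    using assms(1) x by (simp add: sum.remove)
  also have "(\<Sum>y\<in>S - {x}. if Q y then c else 1) = (\<Sum>y\<in>S - {x}. 1)"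
    using uniq by (intro sum.cong) auto
  also have "\<dots> = of_nat (card S) - 1"
    using card.remove[OF assms(1) x(1)] by simp
  finally show ?thesis by simp
qed

subsection \<open>Local weights and the recurrence\<close>

definition local_weight where
  "local_weight a b w p u v \<pi> i =
     (if i \<in> Fix \<pi> then a i else 1) * (if i \<in> Cyc_ge2 \<pi> then b i else 1) *
     (if i \<in> Rlmip \<pi> then w i else 1) * (if i \<in> Excl \<pi> then p i else 1) *
     (if i \<in> Sfix \<pi> then u i else 1) * (if i \<in> Scyc_ge2 \<pi> then v i else (1::'a::comm_ring_1))"

text \<open>All six index sets lie in \<open>{1..n}\<close>, so each product can be padded with ones
  to a product over \<open>{1..n}\<close>, and the six are then merged factor by factor.\<close>

lemma prod_local_weight:
  assumes "partial_perm n \<pi>"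
  shows "(\<Prod>i\<in>Fix \<pi>. a i) * (\<Prod>i\<in>Cyc_ge2 \<pi>. b i) * (\<Prod>i\<in>Rlmip \<pi>. w i) *
    (\<Prod>i\<in>Excl \<pi>. p i) * (\<Prod>i\<in>Sfix \<pi>. u i) * (\<Prod>i\<in>Scyc_ge2 \<pi>. v i) =
    (\<Prod>i=1..n. local_weight a b w p u v \<pi> i)"
proof -
  note P = partial_permD(2)[OF assms]
  have Cyc: "Cyc \<pi> \<subseteq> {1..n}"
    using full_cycle_subset[OF assms] by (meson CycE subset_iff)
  have "Fix \<pi> \<subseteq> {1..n}"
  proof
    fix i assume "i \<in> Fix \<pi>"
    then show "i \<in> {1..n}" using P[of i i] by (simp add: Fix_def)
  qed
  moreover have "Rlmip \<pi> \<subseteq> {1..n}"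
  proof
    fix i assume "i \<in> Rlmip \<pi>"
    then obtain j where "\<pi> i j = 1" by (auto simp: Rlmip_def)
    then show "i \<in> {1..n}" using P[of i j] by simp
  qed
  moreover have "Excl \<pi> \<subseteq> {1..n}"
  proof
    fix j assume "j \<in> Excl \<pi>"
    then obtain i where "\<pi> i j = 1" by (auto simp: Excl_def)
    then show "j \<in> {1..n}" using P[of i j] by simp
  qed
  moreover have "Sfix \<pi> \<subseteq> Fix \<pi>" "Cyc_ge2 \<pi> \<subseteq> Cyc \<pi>" "Scyc_ge2 \<pi> \<subseteq> Cyc \<pi>"
    by (auto simp: Sfix_iff Cyc_ge2_def Scyc_ge2_def Scyc_iff)
  ultimately have sub: "Fix \<pi> \<subseteq> {1..n}" "Cyc_ge2 \<pi> \<subseteq> {1..n}" "Rlmip \<pi> \<subseteq> {1..n}"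
    "Excl \<pi> \<subseteq> {1..n}" "Sfix \<pi> \<subseteq> {1..n}" "Scyc_ge2 \<pi> \<subseteq> {1..n}"
    using Cyc by blast+
  have restrict: "prod f S = (\<Prod>i=1..n. if i \<in> S then f i else 1)" if "S \<subseteq> {1..n}" for f :: "nat \<Rightarrow> 'a" and S
    using prod.inter_restrict[of "{1..n}" f S] that by (simp add: Int_absorb1)
  show ?thesis
    unfolding local_weight_def prod.distrib sub[THEN restrict] by (rule refl)
qed

lemma local_weight_restr:
  "partial_perm m \<pi> \<Longrightarrow> i \<le> n \<Longrightarrow>
    local_weight a b w p u v (restr n \<pi>) i = local_weight a b w p u v \<pi> i"
  by (simp add: local_weight_def Cyc_ge2_def Scyc_ge2_def Sfix_iff Scyc_iff Fix_restr Cyc_restr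
      leading_perm_restr Rlmip_restr Excl_restr)

text \<open>By locality the first \<open>n\<close> factors are those of the old matrix, so a border
  multiplies the weight by a single new factor.\<close>

lemma prod_local_weight_place:
  assumes "partial_perm n \<pi>" "partial_perm (Suc n) (place X \<pi>)"
    and "\<And>i j. (i, j) \<in> X \<Longrightarrow> i = Suc n \<or> j = Suc n"
  shows "(\<Prod>i=1..Suc n. local_weight a b w p u v (place X \<pi>) i) =
    (\<Prod>i=1..n. local_weight a b w p u v \<pi> i) * local_weight a b w p u v (place X \<pi>) (Suc n)"
proof -
  have "local_weight a b w p u v (place X \<pi>) i = local_weight a b w p u v \<pi> i" if "i \<le> n" for i
    using local_weight_restr[OF assms(2) that, of a b w p u v] restr_place[OF assms(1,3)] by simp
  then show ?thesis by (simp add: mult.commute)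
qed

text \<open>At the last index the leading submatrix is the whole matrix, so both strength conditions
  read \<open>k = 0\<close>. A fixed point that is the maximum of a strong cycle is a strong fixed
  point and hence never contributes \<open>v\<close>.\<close>

lemma local_weight_last:
  assumes "\<pi> \<in> partial_perms (Suc n) k"
  shows "local_weight a b w p u v \<pi> (Suc n) =
    (if \<pi> (Suc n) (Suc n) = 1 then a (Suc n) * (if k = 0 then u (Suc n) else 1)
     else if Suc n \<in> Cyc \<pi> then b (Suc n) * (if k = 0 then v (Suc n) else 1) else 1) *
    (if Suc n \<in> Rlmip \<pi> then w (Suc n) else 1) *
    (if \<exists>i\<le>n. \<pi> i (Suc n) = 1 then p (Suc n) else 1)"
proof -
  have "leading_perm \<pi> (Suc n) \<longleftrightarrow> k = 0"
    using assms leading_perm_iff_zero_rows[of "Suc n" \<pi>] by (auto simp: partial_perms_iff)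
  moreover have "Suc n \<in> Fix \<pi> \<longleftrightarrow> \<pi> (Suc n) (Suc n) = 1"
    by (simp add: Fix_def)
  moreover have "Suc n \<in> Excl \<pi> \<longleftrightarrow> (\<exists>i\<le>n. \<pi> i (Suc n) = 1)"
    by (simp add: Excl_def less_Suc_eq_le)
  ultimately show ?thesis
    by (simp add: local_weight_def Cyc_ge2_def Scyc_ge2_def Sfix_iff Scyc_iff)
qed

section \<open>The new factor for each border type\<close>

lemma local_weight_corner:
  assumes "\<pi> \<in> partial_perms n k"
  shows "local_weight a b w p u v (place {(Suc n, Suc n)} \<pi>) (Suc n) =
    a (Suc n) * (if k = 0 then w (Suc n) * u (Suc n) else 1)"
proof -
  have \<pi>: "partial_perm n \<pi>" and k: "card (zero_rows n \<pi>) = k"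
    using assms by (simp_all add: partial_perms_iff)
  have mem: "place {(Suc n, Suc n)} \<pi> \<in> partial_perms (Suc n) k"
    using partial_perms_corner[OF assms] by simp
  have "restr n (place {(Suc n, Suc n)} \<pi>) = \<pi>"
    using \<pi> by (rule restr_place) auto
  \<comment> \<open>Column \<open>n + 1\<close> lies to the right of all old columns, so any zero
    column spoils the minimum. Thus \<open>w\<close> occurs only for \<open>k = 0\<close>, together
    with \<open>u\<close>.\<close>
  moreover have "(\<forall>c\<in>zero_cols n \<pi>. Suc n \<le> c) \<longleftrightarrow> zero_cols n \<pi> = {}"
    by (auto simp: zero_cols_def)
  moreover have "zero_cols n \<pi> = {} \<longleftrightarrow> k = 0"
    using card_zero_cols[OF \<pi>] k by auto
  ultimately have "Suc n \<in> Rlmip (place {(Suc n, Suc n)} \<pi>) \<longleftrightarrow> k = 0"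
    using last_in_Rlmip_iff[of n "place {(Suc n, Suc n)} \<pi>" "Suc n"] mem
    by (simp add: partial_perms_iff place_def)
  moreover have "place {(Suc n, Suc n)} \<pi> (Suc n) (Suc n) = 1"
    by (simp add: place_def)
  moreover have "place {(Suc n, Suc n)} \<pi> i (Suc n) = 0" if "i \<le> n" for i
    using last_row_col_zero[OF \<pi>] that by (simp add: place_def)
  then have "\<not> (\<exists>i\<le>n. place {(Suc n, Suc n)} \<pi> i (Suc n) = 1)"
    by auto
  ultimately show ?thesis
    by (auto simp: local_weight_last[OF mem] mult_ac)
qed

lemma local_weight_empty:
  assumes "\<pi> \<in> partial_perms n k"
  shows "local_weight a b w p u v \<pi> (Suc n) = 1"
proof -
  have \<pi>: "partial_perm n \<pi>" using assms by (simp add: partial_perms_iff)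
  have mem: "\<pi> \<in> partial_perms (Suc n) (Suc k)"
    using partial_perms_empty[OF assms] by simp
  show ?thesis
    using last_row_col_zero[OF \<pi>] Cyc_row_col[of "Suc n" \<pi>]
    by (auto simp: local_weight_last[OF mem] Rlmip_def)
qed

text \<open>The zero row \<open>n + 1\<close> rules out a cycle through \<open>n + 1\<close> and
  membership in \<open>Rlmip\<close>; the 1 above the corner is an excedance.\<close>

lemma local_weight_col:
  assumes "\<pi> \<in> partial_perms n k" "i \<in> zero_rows n \<pi>"
  shows "local_weight a b w p u v (place {(i, Suc n)} \<pi>) (Suc n) = p (Suc n)"
proof -
  have \<pi>: "partial_perm n \<pi>" using assms by (simp add: partial_perms_iff)
  have i: "i \<le> n" using assms(2) by (simp add: zero_rows_def)
  have mem: "place {(i, Suc n)} \<pi> \<in> partial_perms (Suc n) k"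
    using partial_perms_col[OF assms] by simp
  have row: "place {(i, Suc n)} \<pi> (Suc n) j = 0" for j
    using last_row_col_zero[OF \<pi>] i by (simp add: place_def)
  have "Suc n \<notin> Cyc (place {(i, Suc n)} \<pi>)" "Suc n \<notin> Rlmip (place {(i, Suc n)} \<pi>)"
    using Cyc_row_col[of "Suc n" "place {(i, Suc n)} \<pi>"] by (auto simp: Rlmip_def row)
  moreover have "\<exists>i'\<le>n. place {(i, Suc n)} \<pi> i' (Suc n) = 1"
    using i by (auto simp: place_def)
  ultimately show ?thesis
    by (simp add: local_weight_last[OF mem] row)
qed

text \<open>The zero column \<open>n + 1\<close> rules out a cycle and an excedance, so only the
  position of \<open>j\<close> among the zero columns matters.\<close>

lemma local_weight_row:
  assumes "\<pi> \<in> partial_perms n k" "j \<in> zero_cols n \<pi>"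
  shows "local_weight a b w p u v (place {(Suc n, j)} \<pi>) (Suc n) =
    (if \<forall>c\<in>zero_cols n \<pi>. j \<le> c then w (Suc n) else 1)"
proof -
  have \<pi>: "partial_perm n \<pi>" using assms by (simp add: partial_perms_iff)
  have j: "j \<le> n" using assms(2) by (simp add: zero_cols_def)
  have mem: "place {(Suc n, j)} \<pi> \<in> partial_perms (Suc n) k"
    using partial_perms_row[OF assms] by simp
  have col: "place {(Suc n, j)} \<pi> i (Suc n) = 0" for i
    using last_row_col_zero[OF \<pi>] j by (simp add: place_def)
  have "Suc n \<notin> Cyc (place {(Suc n, j)} \<pi>)"
    using Cyc_row_col[of "Suc n" "place {(Suc n, j)} \<pi>"] by (auto simp: col)
  moreover have "restr n (place {(Suc n, j)} \<pi>) = \<pi>"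
    using \<pi> by (rule restr_place) auto
  then have "Suc n \<in> Rlmip (place {(Suc n, j)} \<pi>) \<longleftrightarrow> (\<forall>c\<in>zero_cols n \<pi>. j \<le> c)"
    using last_in_Rlmip_iff[of n "place {(Suc n, j)} \<pi>" j] mem
    by (simp add: partial_perms_iff place_def)
  ultimately show ?thesis
    by (simp add: local_weight_last[OF mem] col)
qed

lemma local_weight_row_col:
  assumes "\<pi> \<in> partial_perms n (Suc k)" "i \<in> zero_rows n \<pi>" "j \<in> zero_cols n \<pi>"
  shows "local_weight a b w p u v (place {(i, Suc n), (Suc n, j)} \<pi>) (Suc n) =
    p (Suc n) * (if \<forall>c\<in>zero_cols n \<pi>. j \<le> c then w (Suc n) else 1) *
    (if (\<lambda>x y. \<pi> x y = 1)\<^sup>*\<^sup>* j i then b (Suc n) * (if k = 0 then v (Suc n) else 1) else 1)"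
proof -
  let ?\<rho> = "place {(i, Suc n), (Suc n, j)} \<pi>"
  have \<pi>: "partial_perm n \<pi>" using assms by (simp add: partial_perms_iff)
  have i: "i \<le> n" and j: "j \<le> n" using assms(2,3) by (simp_all add: zero_rows_def zero_cols_def)
  have mem: "?\<rho> \<in> partial_perms (Suc n) k"
    using partial_perms_row_col[OF assms] by simp
  then have \<rho>: "partial_perm (Suc n) ?\<rho>" by (simp add: partial_perms_iff)
  have corner: "?\<rho> (Suc n) (Suc n) = 0" and row: "?\<rho> (Suc n) j = 1" and col: "?\<rho> i (Suc n) = 1"
    using last_row_col_zero[OF \<pi>] i j by (simp_all add: place_def)
  have restr: "restr n ?\<rho> = \<pi>"
    using \<pi> by (rule restr_place) auto
  have "Suc n \<in> Cyc ?\<rho> \<longleftrightarrow> (\<lambda>x y. \<pi> x y = 1)\<^sup>*\<^sup>* j i"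
    using last_in_Cyc_iff[OF \<rho> col i row j] by (simp only: restr)
  moreover have "Suc n \<in> Rlmip ?\<rho> \<longleftrightarrow> (\<forall>c\<in>zero_cols n \<pi>. j \<le> c)"
    using last_in_Rlmip_iff[OF \<rho> row] by (simp only: restr)
  moreover have "\<exists>i'\<le>n. ?\<rho> i' (Suc n) = 1"
    using i col by blast
  ultimately show ?thesis
    by (simp add: local_weight_last[OF mem] corner mult_ac)
qed

section \<open>Summation over the border choices\<close>

lemma sum_first_zero_col:
  fixes c :: "'a::comm_ring_1"
  assumes "zero_cols n \<pi> \<noteq> {}"
  shows "(\<Sum>j\<in>zero_cols n \<pi>. if \<forall>c\<in>zero_cols n \<pi>. j \<le> c then c else 1) =
    of_nat (card (zero_cols n \<pi>)) - 1 + c"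
proof (rule sum_if_unique)
  show "\<exists>!j. j \<in> zero_cols n \<pi> \<and> (\<forall>c\<in>zero_cols n \<pi>. j \<le> c)"
    using assms by (intro ex1I[of _ "Min (zero_cols n \<pi>)"]) (auto intro: Min_eqI[symmetric])
qed simp

text \<open>The middle coefficient adds the corner, \<open>k\<close> choices of a zero row and
  \<open>k\<close> choices of a zero column. In the last one the old matrix has \<open>k + 1\<close>
  zero rows and columns, one of each being special, which gives \<open>k + b\<close> (or
  \<open>b * v\<close> when \<open>k = 0\<close>) and \<open>k + w\<close>.\<close>

lemma sum_local_weight_Suc:
  fixes a b w p u v :: "nat \<Rightarrow> 'a::comm_ring_1" and k :: nat
  defines "F \<equiv> \<lambda>n k. \<Sum>\<pi>\<in>partial_perms n k. \<Prod>i=1..n. local_weight a b w p u v \<pi> i"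
  shows "F (Suc n) k = (if k = 0 then 0 else F n (k - 1)) +
    (a (Suc n) * (if k = 0 then w (Suc n) * u (Suc n) else 1) + of_nat k * p (Suc n) +
      (if k = 0 then 0 else of_nat k - 1 + w (Suc n))) * F n k +
    (of_nat k + b (Suc n) * (if k = 0 then v (Suc n) else 1)) * (of_nat k + w (Suc n)) *
      p (Suc n) * F n (Suc k)"
proof -
  let ?N = "Suc n"
  let ?lw = "local_weight a b w p u v"
  let ?W = "\<lambda>n \<pi>. \<Prod>i=1..n. ?lw \<pi> i"
  have P: "partial_perm n \<pi>" and cr: "card (zero_rows n \<pi>) = l" and cc: "card (zero_cols n \<pi>) = l"
    if "\<pi> \<in> partial_perms n l" for \<pi> l
    using that card_zero_cols[of n \<pi>] by (simp_all add: partial_perms_iff)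
  have W: "?W ?N (place X \<pi>) = ?W n \<pi> * ?lw (place X \<pi>) ?N"
    if "place X \<pi> \<in> partial_perms ?N k" "\<pi> \<in> partial_perms n l"
      "\<And>i j. (i, j) \<in> X \<Longrightarrow> i = ?N \<or> j = ?N" for X \<pi> l
    using that by (intro prod_local_weight_place) (auto simp: partial_perms_iff)
  have 1: "(if k = 0 then 0 else \<Sum>\<pi>\<in>partial_perms n (k - 1). ?W ?N \<pi>) =
    (if k = 0 then 0 else F n (k - 1))"
  proof (cases "k = 0")
    case False
    \<comment> \<open>The empty border is \<open>place {}\<close>, the identity, so the old and the
      new matrix are the same function.\<close>
    have "?W ?N \<pi> = ?W n \<pi>" if "\<pi> \<in> partial_perms n (k - 1)" for \<pi>
      using W[of "{}" \<pi> "k - 1"] that False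
      by (simp add: partial_perms_empty local_weight_empty del: prod.cl_ivl_Suc)
    then show ?thesis
      using False by (simp add: F_def del: prod.cl_ivl_Suc)
  qed simp
  have 2: "(\<Sum>\<pi>\<in>partial_perms n k. ?W ?N (place {(?N, ?N)} \<pi>)) =
    a ?N * (if k = 0 then w ?N * u ?N else 1) * F n k"
    unfolding F_def sum_distrib_left
  proof (rule sum.cong)
    fix \<pi> assume \<pi>: "\<pi> \<in> partial_perms n k"
    have "?W ?N (place {(?N, ?N)} \<pi>) = ?W n \<pi> * ?lw (place {(?N, ?N)} \<pi>) ?N"
      using \<pi> by (intro W) (auto simp: partial_perms_corner)
    then show "?W ?N (place {(?N, ?N)} \<pi>) = a ?N * (if k = 0 then w ?N * u ?N else 1) * ?W n \<pi>"
      using local_weight_corner[OF \<pi>, of a b w p u v] by (simp only: mult_ac)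
  qed simp
  have 3: "(\<Sum>\<pi>\<in>partial_perms n k. \<Sum>i\<in>zero_rows n \<pi>. ?W ?N (place {(i, ?N)} \<pi>)) =
    of_nat k * p ?N * F n k"
    unfolding F_def sum_distrib_left
  proof (rule sum.cong)
    fix \<pi> assume \<pi>: "\<pi> \<in> partial_perms n k"
    have "?W ?N (place {(i, ?N)} \<pi>) = ?W n \<pi> * p ?N" if "i \<in> zero_rows n \<pi>" for i
      using W[of "{(i, ?N)}" \<pi> k] \<pi> that
      by (simp add: partial_perms_col local_weight_col del: prod.cl_ivl_Suc)
    then have "(\<Sum>i\<in>zero_rows n \<pi>. ?W ?N (place {(i, ?N)} \<pi>)) =
        (\<Sum>i\<in>zero_rows n \<pi>. ?W n \<pi> * p ?N)"
      by (intro sum.cong) simp_all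
    then show "(\<Sum>i\<in>zero_rows n \<pi>. ?W ?N (place {(i, ?N)} \<pi>)) = of_nat k * p ?N * ?W n \<pi>"
      by (simp add: cr[OF \<pi>] mult_ac del: prod.cl_ivl_Suc)
  qed simp
  have 4: "(\<Sum>\<pi>\<in>partial_perms n k. \<Sum>j\<in>zero_cols n \<pi>. ?W ?N (place {(?N, j)} \<pi>)) =
    (if k = 0 then 0 else of_nat k - 1 + w ?N) * F n k"
    unfolding F_def sum_distrib_left
  proof (rule sum.cong)
    fix \<pi> assume \<pi>: "\<pi> \<in> partial_perms n k"
    let ?g = "\<lambda>j. if \<forall>c\<in>zero_cols n \<pi>. j \<le> c then w ?N else 1"
    have "?W ?N (place {(?N, j)} \<pi>) = ?W n \<pi> * ?g j" if "j \<in> zero_cols n \<pi>" for j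
      using W[of "{(?N, j)}" \<pi> k] \<pi> that
      by (simp add: partial_perms_row local_weight_row del: prod.cl_ivl_Suc)
    then have "(\<Sum>j\<in>zero_cols n \<pi>. ?W ?N (place {(?N, j)} \<pi>)) = ?W n \<pi> * (\<Sum>j\<in>zero_cols n \<pi>. ?g j)"
      unfolding sum_distrib_left by (intro sum.cong) simp_all
    \<comment> \<open>The case \<open>k = 0\<close> is separate because the sum is then empty, while
      the general expression would give \<open>w - 1\<close>.\<close>
    also have "(\<Sum>j\<in>zero_cols n \<pi>. ?g j) = (if k = 0 then 0 else of_nat k - 1 + w ?N)"
    proof (cases "k = 0")
      case True
      then have "zero_cols n \<pi> = {}" using cc[OF \<pi>] by simp
      then show ?thesis using True by simp
    next
      case False
      then have "zero_cols n \<pi> \<noteq> {}" using cc[OF \<pi>] by auto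
      then show ?thesis using False sum_first_zero_col[of n \<pi> "w ?N"] cc[OF \<pi>] by simp
    qed
    finally show "(\<Sum>j\<in>zero_cols n \<pi>. ?W ?N (place {(?N, j)} \<pi>)) =
      (if k = 0 then 0 else of_nat k - 1 + w ?N) * ?W n \<pi>"
      by (simp only: mult_ac)
  qed simp
  have 5: "(\<Sum>\<pi>\<in>partial_perms n (Suc k). \<Sum>j\<in>zero_cols n \<pi>. \<Sum>i\<in>zero_rows n \<pi>.
      ?W ?N (place {(i, ?N), (?N, j)} \<pi>)) =
    (of_nat k + b ?N * (if k = 0 then v ?N else 1)) * (of_nat k + w ?N) * p ?N * F n (Suc k)"
    unfolding F_def sum_distrib_left
  proof (rule sum.cong)
    fix \<pi> assume \<pi>: "\<pi> \<in> partial_perms n (Suc k)"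
    let ?g = "\<lambda>j. if \<forall>c\<in>zero_cols n \<pi>. j \<le> c then w ?N else 1"
    let ?bv = "b ?N * (if k = 0 then v ?N else 1)"
    let ?h = "\<lambda>j i. if (\<lambda>x y. \<pi> x y = 1)\<^sup>*\<^sup>* j i then ?bv else 1"
    have "?W ?N (place {(i, ?N), (?N, j)} \<pi>) = ?W n \<pi> * p ?N * (?g j * ?h j i)"
      if "j \<in> zero_cols n \<pi>" "i \<in> zero_rows n \<pi>" for i j
    proof -
      have "?W ?N (place {(i, ?N), (?N, j)} \<pi>) =
          ?W n \<pi> * ?lw (place {(i, ?N), (?N, j)} \<pi>) ?N"
        using \<pi> that by (intro W) (auto simp: partial_perms_row_col)
      then show ?thesis
        unfolding local_weight_row_col[OF \<pi> that(2,1)] by (simp only: mult_ac)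
    qed
    then have "(\<Sum>j\<in>zero_cols n \<pi>. \<Sum>i\<in>zero_rows n \<pi>. ?W ?N (place {(i, ?N), (?N, j)} \<pi>)) =
      ?W n \<pi> * p ?N * (\<Sum>j\<in>zero_cols n \<pi>. ?g j * (\<Sum>i\<in>zero_rows n \<pi>. ?h j i))"
      unfolding sum_distrib_left by (intro sum.cong) simp_all
    \<comment> \<open>Exactly one of the \<open>k + 1\<close> zero rows ends the path from
      \<open>j\<close>, so the inner sum has the same value for every \<open>j\<close> and the
      double sum factors.\<close>
    also have "(\<Sum>j\<in>zero_cols n \<pi>. ?g j * (\<Sum>i\<in>zero_rows n \<pi>. ?h j i)) =
      (\<Sum>j\<in>zero_cols n \<pi>. ?g j * (of_nat k + ?bv))"
    proof (rule sum.cong)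
      fix j assume "j \<in> zero_cols n \<pi>"
      then have "(\<Sum>i\<in>zero_rows n \<pi>. ?h j i) = of_nat (card (zero_rows n \<pi>)) - 1 + ?bv"
        using ex1_path_end[OF P[OF \<pi>]] by (intro sum_if_unique) simp_all
      then show "?g j * (\<Sum>i\<in>zero_rows n \<pi>. ?h j i) = ?g j * (of_nat k + ?bv)"
        using cr[OF \<pi>] by simp
    qed simp
    also have "\<dots> = (of_nat k + w ?N) * (of_nat k + ?bv)"
    proof -
      have "zero_cols n \<pi> \<noteq> {}" using cc[OF \<pi>] by auto
      then show ?thesis
        using sum_first_zero_col[of n \<pi> "w ?N"] cc[OF \<pi>] by (simp add: sum_distrib_right[symmetric])
    qed
    finally show "(\<Sum>j\<in>zero_cols n \<pi>. \<Sum>i\<in>zero_rows n \<pi>. ?W ?N (place {(i, ?N), (?N, j)} \<pi>)) =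
      (of_nat k + ?bv) * (of_nat k + w ?N) * p ?N * ?W n \<pi>"
      by (simp only: mult_ac)
  qed simp
  have "F ?N k = (\<Sum>\<pi>\<in>partial_perms ?N k. ?W ?N \<pi>)"
    by (simp only: F_def)
  then show ?thesis
    unfolding sum_partial_perms_Suc 1 2 3 4 5 by (simp only: distrib_right add.assoc)
qed

section \<open>Base case and induction on the order\<close>

lemma partial_perms_0: "partial_perms 0 k = (if k = 0 then {\<lambda>_ _. 0} else {})"
proof -
  have "partial_perm 0 \<pi> \<longleftrightarrow> \<pi> = (\<lambda>_ _. 0)" for \<pi>
    unfolding partial_perm_def by (auto simp: fun_eq_iff)
  moreover have "zero_rows 0 \<pi> = {}" for \<pi>
    by (simp add: zero_rows_def)
  ultimately have "\<pi> \<in> partial_perms 0 k \<longleftrightarrow> \<pi> = (\<lambda>_ _. 0) \<and> k = 0" for \<pi>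
    by (simp only: partial_perms_iff card.empty eq_commute[of 0 k])
  then show ?thesis by (simp add: set_eq_iff)
qed

theorem theorem5p2:
  fixes a b w p u v :: "nat \<Rightarrow> 'a::comm_ring_1"
    and s t :: "nat \<Rightarrow> nat \<Rightarrow> 'a"
    and n k :: nat
  assumes s0: "\<And>i. i \<ge> 1 \<Longrightarrow> s i 0 = a i * w i * u i"
    and t1: "\<And>i. i \<ge> 1 \<Longrightarrow> t i 1 = b i * w i * p i * v i"
    and s: "\<And>i l. i \<ge> 1 \<Longrightarrow> l \<ge> 1 \<Longrightarrow> s i l = of_nat l - 1 + a i + w i + of_nat l * p i"
    and t: "\<And>i l. i \<ge> 1 \<Longrightarrow> l \<ge> 2 \<Longrightarrow>
              t i l = (of_nat l - 1 + b i) * (of_nat l - 1 + w i) * p i"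
  shows "ext_catalan s t n k =
    (\<Sum>\<pi>\<in>partial_perms n k.
       (\<Prod>i\<in>Fix \<pi>. a i) * (\<Prod>i\<in>Cyc_ge2 \<pi>. b i) * (\<Prod>i\<in>Rlmip \<pi>. w i) *
       (\<Prod>i\<in>Excl \<pi>. p i) * (\<Prod>i\<in>Sfix \<pi>. u i) * (\<Prod>i\<in>Scyc_ge2 \<pi>. v i))"
proof -
  let ?W = "\<lambda>n \<pi>. \<Prod>i=1..n. local_weight a b w p u v \<pi> i"
  have "ext_catalan s t n k = (\<Sum>\<pi>\<in>partial_perms n k. ?W n \<pi>)"
  \<comment> \<open>The column index is generalised because the recurrence at \<open>k\<close> also
    uses \<open>k - 1\<close> and \<open>k + 1\<close>.\<close>
  proof (induction n arbitrary: k)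
    case 0
    then show ?case by (simp add: partial_perms_0)
  next
    case (Suc n)
    have S: "s (Suc n) k = a (Suc n) * (if k = 0 then w (Suc n) * u (Suc n) else 1) +
        of_nat k * p (Suc n) + (if k = 0 then 0 else of_nat k - 1 + w (Suc n))"
      using s0[of "Suc n"] s[of "Suc n" k] by (simp add: algebra_simps)
    \<comment> \<open>With subscript \<open>l = k + 1\<close> the shift \<open>l - 1\<close> becomes
      \<open>k\<close>; for \<open>k = 0\<close> the right side collapses to the special seed
      \<open>t1\<close>.\<close>
    have T: "t (Suc n) (k + 1) = (of_nat k + b (Suc n) * (if k = 0 then v (Suc n) else 1)) *
        (of_nat k + w (Suc n)) * p (Suc n)"
      using t1[of "Suc n"] t[of "Suc n" "k + 1"] by (simp add: mult_ac)
    show ?case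
      unfolding sum_local_weight_Suc ext_catalan.simps Suc.IH S T by (simp only: Suc_eq_plus1)
  qed
  also have "\<dots> = (\<Sum>\<pi>\<in>partial_perms n k.
       (\<Prod>i\<in>Fix \<pi>. a i) * (\<Prod>i\<in>Cyc_ge2 \<pi>. b i) * (\<Prod>i\<in>Rlmip \<pi>. w i) *
       (\<Prod>i\<in>Excl \<pi>. p i) * (\<Prod>i\<in>Sfix \<pi>. u i) * (\<Prod>i\<in>Scyc_ge2 \<pi>. v i))"
    by (intro sum.cong refl prod_local_weight[symmetric]) (simp add: partial_perms_iff)
  finally show ?thesis .
qed

end
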